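(* Let $d_1,d_2,n$ be positive integers, let $A_1,\dots,A_n\in\mathbb{R}^{d_1\times d_2}$ be fixed matrices, let $|||\cdot|||$ be a norm on $\mathbb{R}^{d_1\times d_2}$ with dual norm $|||\cdot|||_*$, let $\alpha>0$, $\sigma>0$, $0<\zeta<1$, and let $\eta_1,\dots,\eta_n$ be i.i.d. $\mathcal{N}(0,\sigma^2)$. Suppose that there exist parameters $\theta,\Gamma>0$ such that $$\sup_{|||M|||\le 1}\left|\frac1n\sum_{k=1}^n \mathrm{tr}(A_k^\top M)^2-\|M\|_{\mathrm F}^2\right|\le\theta$$ and $$\mathbb{E}_{(g_k)}\,\Big|\Big|\Big|\sum_{k=1}^n g_kA_k\Big|\Big|\Big|_*\le\Gamma,$$ where $(g_k)_{k=1}^n$ is a sequence of i.i.d. standard Gaussian random variables. Let $R=\sup_{|||M|||\le1}\|M\|_{\mathrm F}$. Then the following holds with probability at least $1-\zeta$: for every $M_0\in\mathbb{R}^{d_1\times d_2}$ with $|||M_0|||\le\alpha$, the estimate $\Phi$, i.e. a minimizer of $$\sum_{k=1}^n\big(y_k-\mathrm{tr}(A_k^\top M)\big)^2\quad\text{over } M\in\mathbb{R}^{d_1\times d_2}\text{ with } |||M|||\le\alpha,$$ formed from the noisy measurements $y_k=\mathrm{tr}(A_k^\top M_0)+\eta_k$, $k=1,\dots,n$, satisfies $$\|\Phi-M_0\|_{\mathrm F}^2\le 4\alpha^2\theta+\frac{4\alpha\sigma\Gamma}{n}+2\pi\alpha\sigma\sqrt{\frac{2\log(2\zeta^{-1}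)(\theta+R^2)}{n}}.$$
   Context: $\|\cdot\|_{\mathrm F}$ is the Frobenius norm. The dual norm is taken with respect to the trace inner product: $|||B|||_*=\sup\{\mathrm{tr}(B^\top M): |||M|||\le1\}$. The probability is over the noise $(\eta_k)$; the event is common to all $M_0$ (uniform statement). $\log$ is the natural logarithm. *)

theory Defs
  imports "HOL-Probability.Probability"
begin

definition is_norm :: "('v::real_vector \<Rightarrow> real) \<Rightarrow> bool" where
  "is_norm N \<longleftrightarrow>
     (\<forall>x. 0 \<le> N x) \<and>
     (\<forall>x. N x = 0 \<longleftrightarrow> x = 0) \<and>
     (\<forall>c x. N (c *\<^sub>R x) = \<bar>c\<bar> * N x) \<and>
     (\<forall>x y. N (x + y) \<le> N x + N y)"

definition tr_inner :: "real ^ 'd2 ^ 'd1 \<Rightarrow> real ^ 'd2 ^ 'd1 \<Rightarrow> real" where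
  "tr_inner B M = trace (transpose B ** M)"

(* If N is a norm, the set is bounded (finite dimension) and contains 0, so the supremum
   is a genuine one. *)
definition dual_norm :: "(real ^ 'd2 ^ 'd1 \<Rightarrow> real) \<Rightarrow> real ^ 'd2 ^ 'd1 \<Rightarrow> real" where
  "dual_norm N B = (SUP M\<in>{M. N M \<le> 1}. tr_inner B M)"

(* The library norm on real ^ 'd2 ^ 'd1 (a Euclidean norm of Euclidean row norms) is the
   Frobenius norm. *)
lemma norm_matrix_eq_Frobenius:
  fixes M :: "real ^ 'd2 ^ 'd1"
  shows "norm M = sqrt (\<Sum>i\<in>UNIV. \<Sum>j\<in>UNIV. (M $ i $ j)\<^sup>2)"
  by (simp add: norm_vec_def L2_set_def sum_nonneg)

end

theory Submission
  imports Defs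
begin

text \<open>
  The error of the constrained least squares estimate is controlled by a deterministic inequality
  (\<open>least_squares_error_bound\<close>). Since \<open>M0\<close> is itself admissible, a minimizer \<open>\<Phi>\<close> satisfies
  \<open>\<Sum>k. (A\<^sub>k \<bullet> (\<Phi> - M0))\<^sup>2 \<le> 2 Z \<bullet> (\<Phi> - M0)\<close>, where \<open>Z = \<Sum>k. \<eta>\<^sub>k A\<^sub>k\<close>; as
  \<open>\<Phi> - M0\<close> has norm at most \<open>2 \<alpha>\<close>, the right-hand side is at most \<open>4 \<alpha>\<close> times the dual
  norm of \<open>Z\<close>, and the left-hand side differs from \<open>n\<close> times the squared Frobenius norm of
  \<open>\<Phi> - M0\<close> by at most \<open>4 \<alpha>\<^sup>2 \<theta> n\<close>. Everything is thus uniform in \<open>M0\<close> as soon as the dual norm of \<open>Z\<close> is at most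
  \<open>\<sigma> (\<Gamma> + s)\<close> for a suitable deviation \<open>s\<close>.

  The dual norm of \<open>\<Sum>k. x\<^sub>k A\<^sub>k\<close> is a supremum of linear forms in \<open>x\<close> whose coefficient
  vectors have Euclidean length at most \<open>L = sqrt (n (\<theta> + R\<^sup>2))\<close>, so it concentrates around its
  mean: the probability of exceeding the mean by \<open>s\<close> is at most \<open>exp (- 2 s\<^sup>2 / (pi\<^sup>2 L\<^sup>2))\<close>
  (\<open>max_form_concentration\<close>, \<open>dual_norm_concentration\<close>). This is the inequality of Maurey and
  Pisier. In its usual proof, two independent Gaussian vectors \<open>y\<close> and \<open>x\<close> are joined by the
  quarter circle \<open>cos t y + sin t x\<close>, the function is differentiated along it, and one uses that
  position and velocity at each time are again independent standard Gaussian vectors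
  (\<open>nn_integral_std_gauss_PiM_rotate\<close>). A maximum of linear forms is not differentiable; instead,
  the arc is cut into \<open>m\<close> pieces and the maximal form at the end of a piece serves as a
  subgradient (\<open>max_form_rotate_increment\<close>). Homogeneity makes the resulting error of order
  \<open>1 / m\<^sup>2\<close> per piece, so that it disappears as \<open>m\<close> grows.

  The event quantifies over uncountably many \<open>M0\<close> and \<open>\<Phi>\<close>, so its measurability needs an
  argument of its own: the complement is a countable union of projections of closed sets along
  compact ones (\<open>sets_exists_bad_minimizer\<close>).
\<close>

section \<open>Standard Gaussian product measures\<close>

abbreviation std_gauss :: "real measure" where
  "std_gauss \<equiv> density lborel std_normal_density"

abbreviation std_gauss_PiM :: "'i set \<Rightarrow> ('i \<Rightarrow> real) measure" where
  "std_gauss_PiM I \<equiv> PiM I (\<lambda>_. std_gauss)"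

lemma prob_space_std_gauss: "prob_space std_gauss"
  by (rule prob_space_normal_density) simp

lemma prob_space_std_gauss_PiM: "prob_space (std_gauss_PiM I)"
  by (intro prob_space_PiM prob_space_std_gauss)

lemma nn_integral_std_gauss_PiM_density:
  fixes f :: "('i \<Rightarrow> real) \<Rightarrow> ennreal"
  assumes I: "finite I" and f: "f \<in> borel_measurable (PiM I (\<lambda>_. borel))"
  shows "(\<integral>\<^sup>+x. f x \<partial>std_gauss_PiM I) =
    (\<integral>\<^sup>+x. (\<Prod>i\<in>I. ennreal (std_normal_density (x i))) * f x \<partial>PiM I (\<lambda>_. lborel))"
proof -
  interpret L: product_sigma_finite "\<lambda>_::'i. lborel :: real measure" by standard
  interpret G: product_sigma_finite "\<lambda>_::'i. std_gauss"
    by (intro product_sigma_finite.intro prob_space_imp_sigma_finite prob_space_std_gauss)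
  let ?d = "\<lambda>x. \<Prod>i\<in>I. ennreal (std_normal_density (x i))"
  have d[measurable]: "?d \<in> borel_measurable (PiM I (\<lambda>_. lborel))"
    by measurable
  have "density (PiM I (\<lambda>_. lborel)) ?d = std_gauss_PiM I"
  proof (rule G.PiM_eqI[OF I])
    show "sets (density (PiM I (\<lambda>_. lborel)) ?d) = sets (std_gauss_PiM I)"
      by (simp cong: sets_PiM_cong)
    fix A :: "'i \<Rightarrow> real set" assume "\<And>i. i \<in> I \<Longrightarrow> A i \<in> sets std_gauss"
    then have A[measurable]: "\<And>i. i \<in> I \<Longrightarrow> A i \<in> sets borel" by simp
    have "emeasure (density (PiM I (\<lambda>_. lborel)) ?d) (Pi\<^sub>E I A) =
        (\<integral>\<^sup>+x. ?d x * indicator (Pi\<^sub>E I A) x \<partial>PiM I (\<lambda>_. lborel))"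
      using A I by (intro emeasure_density d sets_PiM_I_finite) auto
    also have "\<dots> = (\<integral>\<^sup>+x. (\<Prod>i\<in>I. ennreal (std_normal_density (x i)) * indicator (A i) (x i))
        \<partial>PiM I (\<lambda>_. lborel))"
    proof (rule nn_integral_cong)
      fix x :: "'i \<Rightarrow> real" assume "x \<in> space (PiM I (\<lambda>_. lborel))"
      then have "indicator (Pi\<^sub>E I A) x = (\<Prod>i\<in>I. indicator (A i) (x i) :: ennreal)"
        using I by (auto simp: indicator_def space_PiM PiE_def extensional_def Pi_def prod_zero_iff)
      then show "?d x * indicator (Pi\<^sub>E I A) x =
          (\<Prod>i\<in>I. ennreal (std_normal_density (x i)) * indicator (A i) (x i))"
        by (simp add: prod.distrib)
    qed
    also have "\<dots> = (\<Prod>i\<in>I. \<integral>\<^sup>+x. ennreal (std_normal_density x) * indicator (A i) x \<partial>lborel)"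
      by (rule L.product_nn_integral_prod[OF I]) measurable
    also have "\<dots> = (\<Prod>i\<in>I. emeasure std_gauss (A i))"
      by (intro prod.cong refl emeasure_density[symmetric]) auto
    finally show "emeasure (density (PiM I (\<lambda>_. lborel)) ?d) (Pi\<^sub>E I A) =
        (\<Prod>i\<in>I. emeasure std_gauss (A i))" .
  qed
  then have "(\<integral>\<^sup>+x. f x \<partial>std_gauss_PiM I) =
      (\<integral>\<^sup>+x. f x \<partial>density (PiM I (\<lambda>_. lborel)) ?d)" by simp
  also have "\<dots> = (\<integral>\<^sup>+x. ?d x * f x \<partial>PiM I (\<lambda>_. lborel))"
    using f by (intro nn_integral_density d) (simp cong: measurable_cong_sets sets_PiM_cong)
  finally show ?thesis .
qed

text \<open>
  Addition of a multiple of a vector, restricted to \<open>I\<close> because the points of a product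
  measure are extensional functions.
\<close>

definition axpy :: "'i set \<Rightarrow> real \<Rightarrow> ('i \<Rightarrow> real) \<Rightarrow> ('i \<Rightarrow> real) \<Rightarrow> 'i \<Rightarrow> real" where
  "axpy I a x y = (\<lambda>i\<in>I. x i + a * y i)"

text \<open>
  Coordinatewise, this is translation invariance of Lebesgue measure on the line, which
  carries over to the product because both sides agree on boxes.
\<close>

lemma nn_integral_lborel_PiM_translate:
  fixes f :: "('i \<Rightarrow> real) \<Rightarrow> ennreal"
  assumes I: "finite I" and f: "f \<in> borel_measurable (PiM I (\<lambda>_. borel))"
  shows "(\<integral>\<^sup>+x. f (axpy I a x y) \<partial>PiM I (\<lambda>_. lborel)) = (\<integral>\<^sup>+x. f x \<partial>PiM I (\<lambda>_. lborel))"
proof -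
  interpret L: product_sigma_finite "\<lambda>_::'i. lborel :: real measure" by standard
  let ?L = "PiM I (\<lambda>_. lborel) :: ('i \<Rightarrow> real) measure"
  have T: "(\<lambda>x. axpy I a x y) \<in> measurable ?L ?L"
    unfolding axpy_def by measurable
  have "distr ?L ?L (\<lambda>x. axpy I a x y) = ?L"
  proof (rule L.PiM_eqI[OF I])
    fix A :: "'i \<Rightarrow> real set" assume "\<And>i. i \<in> I \<Longrightarrow> A i \<in> sets lborel"
    then have A: "\<And>i. i \<in> I \<Longrightarrow> A i \<in> sets borel" by simp
    let ?B = "\<lambda>i. (\<lambda>t. a * y i + t) -` A i"
    have B: "?B i \<in> sets borel" if "i \<in> I" for i
      using measurable_sets[of "\<lambda>t. a * y i + t" borel borel "A i"] A[OF that] by simp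
    have "emeasure (distr ?L ?L (\<lambda>x. axpy I a x y)) (Pi\<^sub>E I A) =
        emeasure ?L ((\<lambda>x. axpy I a x y) -` Pi\<^sub>E I A \<inter> space ?L)"
      using A I by (intro emeasure_distr T sets_PiM_I_finite) auto
    also have "(\<lambda>x. axpy I a x y) -` Pi\<^sub>E I A \<inter> space ?L = Pi\<^sub>E I ?B"
      by (auto simp: axpy_def space_PiM PiE_def Pi_def add.commute)
    also have "emeasure ?L (Pi\<^sub>E I ?B) = (\<Prod>i\<in>I. emeasure lborel (?B i))"
      using B by (intro L.emeasure_PiM I) auto
    also have "\<dots> = (\<Prod>i\<in>I. emeasure lborel (A i))"
    proof (rule prod.cong[OF refl])
      fix i assume i: "i \<in> I"
      have "emeasure lborel (A i) = emeasure (distr lborel borel ((+) (a * y i))) (A i)"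
        by (simp add: lborel_distr_plus)
      also have "\<dots> = emeasure lborel (?B i)"
        using A[OF i] by (subst emeasure_distr) auto
      finally show "emeasure lborel (?B i) = emeasure lborel (A i)" by simp
    qed
    finally show "emeasure (distr ?L ?L (\<lambda>x. axpy I a x y)) (Pi\<^sub>E I A) =
        (\<Prod>i\<in>I. emeasure lborel (A i))" .
  qed simp
  then have "(\<integral>\<^sup>+x. f x \<partial>?L) = (\<integral>\<^sup>+x. f x \<partial>distr ?L ?L (\<lambda>x. axpy I a x y))" by simp
  also have "\<dots> = (\<integral>\<^sup>+x. f (axpy I a x y) \<partial>?L)"
    using f by (intro nn_integral_distr T) (simp cong: measurable_cong_sets sets_PiM_cong)
  finally show ?thesis by simp
qed

lemma measurable_axpy[measurable (raw)]:
  assumes "f \<in> measurable M (PiM I (\<lambda>_. borel))" "g \<in> measurable M (PiM I (\<lambda>_. borel))"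
  shows "(\<lambda>x. axpy I a (f x) (g x)) \<in> measurable M (PiM I (\<lambda>_. borel))"
proof -
  have "(\<lambda>x. f x i) \<in> borel_measurable M" "(\<lambda>x. g x i) \<in> borel_measurable M" if "i \<in> I" for i
    using assms[THEN measurable_component_singleton[OF that, THEN measurable_compose[rotated]]] by auto
  then show ?thesis unfolding axpy_def by (intro measurable_restrict) auto
qed

text \<open>
  For two independent standard Gaussian vectors \<open>x\<close> and \<open>y\<close>, the pair
  \<open>(c x + s y, c y - s x)\<close> has the law of \<open>(x, y)\<close>. The joint density depends on
  \<open>x\<^sub>i\<^sup>2 + y\<^sub>i\<^sup>2\<close> only, which a rotation preserves, so it suffices that the rotation
  preserves the Lebesgue product measure. A rotation by an angle \<open>t\<close> other than a half turn is a
  product of three shears, with parameters \<open>tan (t / 2)\<close>, \<open>- sin t\<close>, \<open>tan (t / 2)\<close>; by Fubini, a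
  shear acts as a translation in one of the two vectors.
\<close>

lemma nn_integral_std_gauss_PiM_rotate:
  fixes f :: "('i \<Rightarrow> real) \<times> ('i \<Rightarrow> real) \<Rightarrow> ennreal"
  assumes I: "finite I"
    and f[measurable]: "f \<in> borel_measurable (PiM I (\<lambda>_. borel) \<Otimes>\<^sub>M PiM I (\<lambda>_. borel))"
    and cs: "c\<^sup>2 + s\<^sup>2 = 1" and c: "c \<noteq> -1"
  shows "(\<integral>\<^sup>+x. \<integral>\<^sup>+y. f (\<lambda>i\<in>I. c * x i + s * y i, \<lambda>i\<in>I. c * y i - s * x i)
        \<partial>std_gauss_PiM I \<partial>std_gauss_PiM I) =
    (\<integral>\<^sup>+x. \<integral>\<^sup>+y. f (x, y) \<partial>std_gauss_PiM I \<partial>std_gauss_PiM I)"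
proof -
  interpret L: product_sigma_finite "\<lambda>_::'i. lborel :: real measure" by standard
  interpret LI: sigma_finite_measure "PiM I (\<lambda>_. lborel) :: ('i \<Rightarrow> real) measure"
    by (rule L.sigma_finite[OF I])
  interpret LL: pair_sigma_finite "PiM I (\<lambda>_. lborel) :: ('i \<Rightarrow> real) measure"
      "PiM I (\<lambda>_. lborel) :: ('i \<Rightarrow> real) measure" ..
  interpret GI: prob_space "std_gauss_PiM I" by (rule prob_space_std_gauss_PiM)
  let ?L = "PiM I (\<lambda>_. lborel) :: ('i \<Rightarrow> real) measure"
  let ?B = "PiM I (\<lambda>_. borel) :: ('i \<Rightarrow> real) measure"
  let ?d = "\<lambda>x. \<Prod>i\<in>I. ennreal (std_normal_density (x i))"
  have sets_L: "sets ?L = sets ?B" by (simp cong: sets_PiM_cong)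
  have sets_G: "sets (std_gauss_PiM I) = sets ?B" by (simp cong: sets_PiM_cong)
  note [measurable_cong] = sets_L sets_G
  have d[measurable]: "?d \<in> borel_measurable ?B" by measurable
  have dens: "(\<integral>\<^sup>+x. \<integral>\<^sup>+y. h (x, y) \<partial>std_gauss_PiM I \<partial>std_gauss_PiM I) =
      (\<integral>\<^sup>+x. \<integral>\<^sup>+y. (?d x * ?d y) * h (x, y) \<partial>?L \<partial>?L)"
    if h[measurable]: "h \<in> borel_measurable (?B \<Otimes>\<^sub>M ?B)" for h :: "_ \<Rightarrow> ennreal"
  proof -
    have "(\<integral>\<^sup>+x. \<integral>\<^sup>+y. h (x, y) \<partial>std_gauss_PiM I \<partial>std_gauss_PiM I) =
        (\<integral>\<^sup>+x. ?d x * (\<integral>\<^sup>+y. h (x, y) \<partial>std_gauss_PiM I) \<partial>?L)"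
      by (rule nn_integral_std_gauss_PiM_density[OF I]) measurable
    also have "\<dots> = (\<integral>\<^sup>+x. ?d x * (\<integral>\<^sup>+y. ?d y * h (x, y) \<partial>?L) \<partial>?L)"
      by (intro nn_integral_cong arg_cong2[where f="(*)"] refl nn_integral_std_gauss_PiM_density[OF I])
         (auto simp: space_PiM intro!: measurable_compose[OF _ h])
    also have "\<dots> = (\<integral>\<^sup>+x. \<integral>\<^sup>+y. ?d x * (?d y * h (x, y)) \<partial>?L \<partial>?L)"
      by (intro nn_integral_cong nn_integral_cmult[symmetric])
         (auto simp: space_PiM intro!: measurable_compose[OF _ h] borel_measurable_times)
    finally show ?thesis by (simp add: mult.assoc)
  qed
  have shear2: "(\<integral>\<^sup>+x. \<integral>\<^sup>+y. h (x, axpy I a y x) \<partial>?L \<partial>?L) = (\<integral>\<^sup>+x. \<integral>\<^sup>+y. h (x, y) \<partial>?L \<partial>?L)"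
    if h[measurable]: "h \<in> borel_measurable (?B \<Otimes>\<^sub>M ?B)" for h :: "_ \<Rightarrow> ennreal" and a
    by (intro nn_integral_cong nn_integral_lborel_PiM_translate[OF I, where f="\<lambda>y. h (_, y)"])
       (auto simp: space_PiM intro!: measurable_compose[OF _ h])
  have swap: "(\<integral>\<^sup>+x. \<integral>\<^sup>+y. h (x, y) \<partial>?L \<partial>?L) = (\<integral>\<^sup>+y. \<integral>\<^sup>+x. h (x, y) \<partial>?L \<partial>?L)"
    if h[measurable]: "h \<in> borel_measurable (?B \<Otimes>\<^sub>M ?B)" for h :: "_ \<Rightarrow> ennreal"
    using LL.Fubini[of h] by simp
  have shear1: "(\<integral>\<^sup>+x. \<integral>\<^sup>+y. h (axpy I a x y, y) \<partial>?L \<partial>?L) = (\<integral>\<^sup>+x. \<integral>\<^sup>+y. h (x, y) \<partial>?L \<partial>?L)"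
    if h[measurable]: "h \<in> borel_measurable (?B \<Otimes>\<^sub>M ?B)" for h :: "_ \<Rightarrow> ennreal" and a
  proof -
    have "(\<integral>\<^sup>+x. \<integral>\<^sup>+y. h (axpy I a x y, y) \<partial>?L \<partial>?L) = (\<integral>\<^sup>+y. \<integral>\<^sup>+x. h (axpy I a x y, y) \<partial>?L \<partial>?L)"
      using swap[of "\<lambda>(x, y). h (axpy I a x y, y)"] by simp
    also have "\<dots> = (\<integral>\<^sup>+y. \<integral>\<^sup>+x. h (x, y) \<partial>?L \<partial>?L)"
      using shear2[of "\<lambda>(x, y). h (y, x)" a] by simp
    finally show ?thesis by (simp add: swap)
  qed
  \<comment> \<open>Half-angle formula: \<open>a = tan (t / 2)\<close> when \<open>c = cos t\<close> and \<open>s = sin t\<close>.\<close>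
  define a where "a = s / (1 + c)"
  have c': "1 + c \<noteq> 0" using c by auto
  have "a * s = s\<^sup>2 / (1 + c)" by (simp add: a_def power2_eq_square)
  also have "\<dots> = 1 - c" using cs c' by (simp add: field_simps power2_eq_square)
  finally have as: "a * s = 1 - c" .
  have ac: "a * (1 + c) = s" using c' by (simp add: a_def)
  let ?g = "\<lambda>(x, y). (?d x * ?d y) * f (x, y)"
  let ?r = "\<lambda>x y. (\<lambda>i\<in>I. c * x i + s * y i, \<lambda>i\<in>I. c * y i - s * x i)"
  have three_shears: "?r x y = (axpy I a (axpy I a x y) (axpy I (-s) y (axpy I a x y)),
      axpy I (-s) y (axpy I a x y))" for x y
  proof -
    have "c * x i + s * y i = x i + a * y i + a * (y i - s * (x i + a * y i))"
        "c * y i - s * x i = y i - s * (x i + a * y i)" for i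
    proof -
      have "y i - s * (x i + a * y i) = (1 - a * s) * y i - s * x i" by (simp add: algebra_simps)
      then show *: "c * y i - s * x i = y i - s * (x i + a * y i)" using as by simp
      have "x i + a * y i + a * (c * y i - s * x i) = (1 - a * s) * x i + a * (1 + c) * y i"
        by (simp add: algebra_simps)
      then show "c * x i + s * y i = x i + a * y i + a * (y i - s * (x i + a * y i))"
        unfolding *[symmetric] as ac by simp
    qed
    then show ?thesis by (auto simp: axpy_def fun_eq_iff)
  qed
  have dens_rot: "?d (\<lambda>i\<in>I. c * x i + s * y i) * ?d (\<lambda>i\<in>I. c * y i - s * x i) = ?d x * ?d y" for x y
  proof -
    have "std_normal_density (c * u + s * v) * std_normal_density (c * v - s * u) =
        std_normal_density u * std_normal_density v" for u v
    proof -
      have "(c * u + s * v)\<^sup>2 + (c * v - s * u)\<^sup>2 = (c\<^sup>2 + s\<^sup>2) * (u\<^sup>2 + v\<^sup>2)"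
        by (simp add: power2_eq_square algebra_simps)
      then have "- (c * u + s * v)\<^sup>2 / 2 + - (c * v - s * u)\<^sup>2 / 2 = - u\<^sup>2 / 2 + - v\<^sup>2 / 2"
        using cs by simp
      then have "exp (- (c * u + s * v)\<^sup>2 / 2) * exp (- (c * v - s * u)\<^sup>2 / 2) =
          exp (- u\<^sup>2 / 2) * exp (- v\<^sup>2 / 2)"
        unfolding exp_add[symmetric] by simp
      then show ?thesis by (simp add: std_normal_density_def)
    qed
    then show ?thesis
      by (simp add: prod.distrib[symmetric] ennreal_mult'[symmetric] cong: prod.cong)
  qed
  have "(\<integral>\<^sup>+x. \<integral>\<^sup>+y. f (?r x y) \<partial>std_gauss_PiM I \<partial>std_gauss_PiM I) =
      (\<integral>\<^sup>+x. \<integral>\<^sup>+y. (?d x * ?d y) * f (?r x y) \<partial>?L \<partial>?L)"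
    using dens[of "\<lambda>(x, y). f (?r x y)"] by simp
  also have "\<dots> = (\<integral>\<^sup>+x. \<integral>\<^sup>+y. ?g (?r x y) \<partial>?L \<partial>?L)"
    by (simp only: prod.case dens_rot)
  also have "\<dots> = (\<integral>\<^sup>+x. \<integral>\<^sup>+y. ?g (x, y) \<partial>?L \<partial>?L)"
    unfolding three_shears
    using shear1[of "\<lambda>(x, y). ?g (axpy I a x (axpy I (-s) y x), axpy I (-s) y x)" a]
      shear2[of "\<lambda>(x, y). ?g (axpy I a x y, y)" "-s"] shear1[of ?g a] by simp
  also have "\<dots> = (\<integral>\<^sup>+x. \<integral>\<^sup>+y. f (x, y) \<partial>std_gauss_PiM I \<partial>std_gauss_PiM I)"
    using dens[of f] by simp
  finally show ?thesis .
qed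

text \<open>
  Completing the square turns the integrand into a multiple of the density of the normal law
  with mean \<open>t\<close>.
\<close>

lemma nn_integral_std_gauss_exp:
  "(\<integral>\<^sup>+x. ennreal (exp (t * x)) \<partial>std_gauss) = ennreal (exp (t\<^sup>2 / 2))"
proof -
  have "(\<integral>\<^sup>+x. ennreal (exp (t * x)) \<partial>std_gauss) =
      (\<integral>\<^sup>+x. ennreal (std_normal_density x) * ennreal (exp (t * x)) \<partial>lborel)"
    by (rule nn_integral_density) auto
  also have "\<dots> = (\<integral>\<^sup>+x. ennreal (exp (t\<^sup>2 / 2)) * ennreal (normal_density t 1 x) \<partial>lborel)"
  proof (rule nn_integral_cong)
    fix x
    have "- x\<^sup>2 / 2 + t * x = t\<^sup>2 / 2 + - (x - t)\<^sup>2 / 2" by (simp add: power2_eq_square field_simps)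
    then have "exp (- x\<^sup>2 / 2) * exp (t * x) = exp (t\<^sup>2 / 2) * exp (- (x - t)\<^sup>2 / 2)"
      unfolding exp_add[symmetric] by simp
    then have "std_normal_density x * exp (t * x) = exp (t\<^sup>2 / 2) * normal_density t 1 x"
      by (simp add: normal_density_def)
    then show "ennreal (std_normal_density x) * ennreal (exp (t * x)) =
        ennreal (exp (t\<^sup>2 / 2)) * ennreal (normal_density t 1 x)"
      by (simp add: ennreal_mult'[symmetric])
  qed
  also have "\<dots> = ennreal (exp (t\<^sup>2 / 2))"
    by (subst nn_integral_cmult) (auto simp: nn_integral_eq_integral)
  finally show ?thesis .
qed

lemma nn_integral_std_gauss_PiM_exp:
  assumes I: "finite I"
  shows "(\<integral>\<^sup>+x. ennreal (exp (\<Sum>i\<in>I. a i * x i)) \<partial>std_gauss_PiM I) =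
    ennreal (exp ((\<Sum>i\<in>I. (a i)\<^sup>2) / 2))"
proof -
  interpret G: product_sigma_finite "\<lambda>_. std_gauss"
    by (intro product_sigma_finite.intro prob_space_imp_sigma_finite prob_space_std_gauss)
  have "(\<integral>\<^sup>+x. ennreal (exp (\<Sum>i\<in>I. a i * x i)) \<partial>std_gauss_PiM I) =
      (\<integral>\<^sup>+x. (\<Prod>i\<in>I. ennreal (exp (a i * x i))) \<partial>std_gauss_PiM I)"
    using I by (simp add: exp_sum prod_ennreal)
  also have "\<dots> = (\<Prod>i\<in>I. \<integral>\<^sup>+x. ennreal (exp (a i * x)) \<partial>std_gauss)"
    by (rule G.product_nn_integral_prod[OF I]) auto
  also have "\<dots> = ennreal (exp ((\<Sum>i\<in>I. (a i)\<^sup>2) / 2))"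
    using I by (simp add: nn_integral_std_gauss_exp prod_ennreal exp_sum[symmetric] sum_divide_distrib)
  finally show ?thesis .
qed

section \<open>Gaussian concentration for maxima of linear forms\<close>

definition linform :: "'i set \<Rightarrow> ('i \<Rightarrow> real) \<Rightarrow> ('i \<Rightarrow> real) \<Rightarrow> real" where
  "linform I a x = (\<Sum>i\<in>I. a i * x i)"

definition max_form :: "'i set \<Rightarrow> (nat \<Rightarrow> 'i \<Rightarrow> real) \<Rightarrow> nat \<Rightarrow> ('i \<Rightarrow> real) \<Rightarrow> real" where
  "max_form I a p x = Max ((\<lambda>j. linform I (a j) x) ` {..<p})"

text \<open>
  The first index at which the maximum is attained. The coefficient vector at this index is a
  subgradient of \<open>max_form\<close> at \<open>x\<close>; taking the first index makes the choice measurable.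
\<close>

definition max_index :: "'i set \<Rightarrow> (nat \<Rightarrow> 'i \<Rightarrow> real) \<Rightarrow> nat \<Rightarrow> ('i \<Rightarrow> real) \<Rightarrow> nat" where
  "max_index I a p x = (LEAST j. j < p \<and> linform I (a j) x = max_form I a p x)"

lemma linform_restrict[simp]: "linform I a (restrict x I) = linform I a x"
  by (simp add: linform_def)

lemma max_form_restrict[simp]: "max_form I a p (restrict x I) = max_form I a p x"
  by (simp add: max_form_def)

lemma max_index_restrict[simp]: "max_index I a p (restrict x I) = max_index I a p x"
  by (simp add: max_index_def)

lemma linform_lincomb:
  "linform I a (\<lambda>i. c * x i + d * y i) = c * linform I a x + d * linform I a y"
  by (simp add: linform_def sum.distrib sum_distrib_left algebra_simps)

lemma linform_le_max_form: "j < p \<Longrightarrow> linform I (a j) x \<le> max_form I a p x"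
  unfolding max_form_def by (intro Max_ge) auto

lemma max_index:
  assumes "p > 0"
  shows "max_index I a p x < p" "linform I (a (max_index I a p x)) x = max_form I a p x"
proof -
  have "max_form I a p x \<in> (\<lambda>j. linform I (a j) x) ` {..<p}"
    unfolding max_form_def using assms by (intro Max_in) auto
  then have "\<exists>j. j < p \<and> linform I (a j) x = max_form I a p x" by auto
  from LeastI_ex[OF this]
  show "max_index I a p x < p" "linform I (a (max_index I a p x)) x = max_form I a p x"
    unfolding max_index_def by auto
qed

lemma measurable_linform[measurable]: "linform I a \<in> borel_measurable (PiM I (\<lambda>_. borel))"
  unfolding linform_def by measurable

lemma measurable_max_form[measurable]: "max_form I a p \<in> borel_measurable (PiM I (\<lambda>_. borel))"
  unfolding max_form_def by (intro borel_measurable_Max) auto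

lemma measurable_max_index[measurable]:
  "max_index I a p \<in> measurable (PiM I (\<lambda>_. borel)) (count_space UNIV)"
  unfolding max_index_def
proof (rule measurable_Least)
  fix j
  have "(\<lambda>x. linform I (a j) x - max_form I a p x) \<in> borel_measurable (PiM I (\<lambda>_. borel))"
    by (intro borel_measurable_diff measurable_linform measurable_max_form)
  then have "Measurable.pred (PiM I (\<lambda>_. borel)) (\<lambda>x. linform I (a j) x - max_form I a p x = 0)"
    by (rule pred_eq_const1) simp
  then show "Measurable.pred (PiM I (\<lambda>_. borel)) (\<lambda>x. j < p \<and> linform I (a j) x = max_form I a p x)"
    by (cases "j < p") simp_all
qed

lemma sets_std_gauss_PiM[measurable_cong]: "sets (std_gauss_PiM I) = sets (PiM I (\<lambda>_. borel))"
  by (simp cong: sets_PiM_cong)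

text \<open>
  The step that replaces differentiation along the arc from \<open>y\<close> to \<open>x\<close>. Write \<open>X\<close> for the
  point at angle \<open>t + d\<close> and \<open>X'\<close> for the velocity there, so that the point at angle \<open>t\<close> is
  \<open>cos d X - sin d X'\<close>. The form that is maximal at \<open>X\<close> bounds \<open>max_form\<close> from below at the
  earlier point, and since it is linear, its value there is \<open>cos d\<close> times the maximum at \<open>X\<close>
  minus \<open>sin d\<close> times its value at \<open>X'\<close>.
  The price \<open>1 - cos d\<close> for having no smoothness is of second order in \<open>d\<close>.
\<close>

lemma max_form_rotate_increment:
  assumes p: "p > 0"
  shows "max_form I a p (\<lambda>i. cos (t + d) * y i + sin (t + d) * x i)
        - max_form I a p (\<lambda>i. cos t * y i + sin t * x i)
    \<le> (1 - cos d) * max_form I a p (\<lambda>i. cos (t + d) * y i + sin (t + d) * x i)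
      + sin d * linform I (a (max_index I a p (\<lambda>i. cos (t + d) * y i + sin (t + d) * x i)))
          (\<lambda>i. cos (t + d) * x i - sin (t + d) * y i)"
proof -
  define X where "X = (\<lambda>i. cos (t + d) * y i + sin (t + d) * x i)"
  define X' where "X' = (\<lambda>i. cos (t + d) * x i - sin (t + d) * y i)"
  define j where "j = max_index I a p X"
  have "cos t * y i + sin t * x i = cos d * X i + (- sin d) * X' i" for i
  proof -
    have t: "t = (t + d) - d" by simp
    have "cos t = cos (t + d) * cos d + sin (t + d) * sin d"
      by (subst t) (rule cos_diff)
    moreover have "sin t = sin (t + d) * cos d - cos (t + d) * sin d"
      by (subst t) (rule sin_diff)
    ultimately show ?thesis
      unfolding X_def X'_def by (simp only:) (simp add: algebra_simps)
  qed
  then have "linform I (a j) (\<lambda>i. cos t * y i + sin t * x i) =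
      cos d * linform I (a j) X + (- sin d) * linform I (a j) X'"
    by (simp only: linform_lincomb)
  moreover have "linform I (a j) (\<lambda>i. cos t * y i + sin t * x i) \<le>
      max_form I a p (\<lambda>i. cos t * y i + sin t * x i)"
    using max_index[OF p] by (intro linform_le_max_form) (simp add: j_def)
  moreover have "linform I (a j) X = max_form I a p X"
    using max_index[OF p] by (simp add: j_def)
  ultimately have "max_form I a p X - max_form I a p (\<lambda>i. cos t * y i + sin t * x i)
      \<le> (1 - cos d) * max_form I a p X + sin d * linform I (a j) X'"
    by (simp add: algebra_simps)
  then show ?thesis by (simp add: X_def X'_def j_def)
qed

lemma nn_integral_exp_linform:
  assumes "finite I"
  shows "(\<integral>\<^sup>+x. ennreal (exp (t * linform I a x)) \<partial>std_gauss_PiM I) =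
    ennreal (exp (t\<^sup>2 * (\<Sum>i\<in>I. (a i)\<^sup>2) / 2))"
proof -
  have "(\<Sum>i\<in>I. t * a i * x i) = t * linform I a x" for x
    by (simp add: linform_def sum_distrib_left mult.assoc)
  moreover have "(\<Sum>i\<in>I. (t * a i)\<^sup>2) = t\<^sup>2 * (\<Sum>i\<in>I. (a i)\<^sup>2)"
    by (simp add: sum_distrib_left power_mult_distrib)
  ultimately show ?thesis
    using nn_integral_std_gauss_PiM_exp[OF assms, of "\<lambda>i. t * a i"] by (simp only:)
qed

text \<open>
  By convexity \<open>exp (e u) \<le> 1 - e + e exp u\<close>, and the exponential of a maximum is at most
  the sum of the exponentials. The dependence on the number \<open>p\<close> of forms does no harm, since the
  bound is used with \<open>e\<close> tending to 0.
\<close>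

lemma nn_integral_exp_small_max_form:
  assumes I: "finite I" and p: "p > 0" and e: "0 \<le> e" "e \<le> 1"
    and L: "\<And>j. j < p \<Longrightarrow> (\<Sum>i\<in>I. (a j i)\<^sup>2) \<le> L\<^sup>2"
  shows "(\<integral>\<^sup>+x. ennreal (exp (e * max_form I a p x)) \<partial>std_gauss_PiM I)
    \<le> ennreal (1 + e * (real p * exp (L\<^sup>2 / 2)))"
proof -
  interpret G: prob_space "std_gauss_PiM I" by (rule prob_space_std_gauss_PiM)
  have "(\<integral>\<^sup>+x. ennreal (exp (e * max_form I a p x)) \<partial>std_gauss_PiM I) \<le>
      (\<integral>\<^sup>+x. 1 + ennreal e * (\<Sum>j<p. ennreal (exp (1 * linform I (a j) x))) \<partial>std_gauss_PiM I)"
  proof (rule nn_integral_mono)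
    fix x
    let ?u = "max_form I a p x"
    have "exp ((1 - e) *\<^sub>R 0 + e *\<^sub>R ?u) \<le> (1 - e) * exp 0 + e * exp ?u"
      using e by (intro convex_onD[OF exp_convex, of e 0 ?u]) auto
    moreover have "exp ?u \<le> (\<Sum>j<p. exp (linform I (a j) x))"
      unfolding max_index(2)[OF p, symmetric, of I a x]
      using max_index(1)[OF p, of I a x] by (intro member_le_sum) auto
    then have "e * exp ?u \<le> e * (\<Sum>j<p. exp (linform I (a j) x))"
      using e by (intro mult_left_mono) auto
    ultimately have "exp (e * ?u) \<le> 1 + e * (\<Sum>j<p. exp (linform I (a j) x))"
      using e by simp
    then have "ennreal (exp (e * ?u)) \<le> ennreal (1 + e * (\<Sum>j<p. exp (linform I (a j) x)))"
      by (rule ennreal_leI)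
    also have "\<dots> = 1 + ennreal e * (\<Sum>j<p. ennreal (exp (1 * linform I (a j) x)))"
      using e by (simp add: ennreal_plus ennreal_mult sum_nonneg sum_ennreal)
    finally show "ennreal (exp (e * ?u)) \<le> \<dots>" .
  qed
  also have "\<dots> = 1 + ennreal e * (\<Sum>j<p. \<integral>\<^sup>+x. ennreal (exp (1 * linform I (a j) x)) \<partial>std_gauss_PiM I)"
    by (subst nn_integral_add) (auto simp: nn_integral_cmult nn_integral_sum G.emeasure_space_1 simp del: sum_ennreal)
  also have "\<dots> = 1 + ennreal e * (\<Sum>j<p. ennreal (exp ((\<Sum>i\<in>I. (a j i)\<^sup>2) / 2)))"
    by (simp only: nn_integral_exp_linform[OF I]) simp
  also have "\<dots> \<le> 1 + ennreal e * (\<Sum>j<p. ennreal (exp (L\<^sup>2 / 2)))"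
    using L by (intro add_left_mono mult_left_mono sum_mono ennreal_leI) auto
  also have "\<dots> = ennreal (1 + e * (real p * exp (L\<^sup>2 / 2)))"
    using e by (simp add: ennreal_plus ennreal_mult ennreal_of_nat_eq_real_of_nat)
  finally show ?thesis .
qed

text \<open>
  The velocity \<open>y\<close> is independent of the position \<open>x\<close>. Integrating over \<open>y\<close> first, with
  the maximal form at \<open>x\<close> frozen, leaves the Gaussian moment generating function of a form of
  squared length at most \<open>L\<^sup>2\<close>.
\<close>

lemma nn_integral_exp_max_form_linform:
  assumes I: "finite I" and p: "p > 0"
    and L: "\<And>j. j < p \<Longrightarrow> (\<Sum>i\<in>I. (a j i)\<^sup>2) \<le> L\<^sup>2"
  shows "(\<integral>\<^sup>+x. \<integral>\<^sup>+y. ennreal (exp (e * max_form I a p x + t * linform I (a (max_index I a p x)) y))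
        \<partial>std_gauss_PiM I \<partial>std_gauss_PiM I)
    \<le> ennreal (exp (t\<^sup>2 * L\<^sup>2 / 2)) * (\<integral>\<^sup>+x. ennreal (exp (e * max_form I a p x)) \<partial>std_gauss_PiM I)"
proof -
  have "(\<integral>\<^sup>+y. ennreal (exp (e * max_form I a p x + t * linform I (a (max_index I a p x)) y))
        \<partial>std_gauss_PiM I) \<le> ennreal (exp (t\<^sup>2 * L\<^sup>2 / 2)) * ennreal (exp (e * max_form I a p x))" for x
  proof -
    let ?j = "max_index I a p x"
    have "(\<integral>\<^sup>+y. ennreal (exp (e * max_form I a p x + t * linform I (a ?j) y)) \<partial>std_gauss_PiM I) =
        (\<integral>\<^sup>+y. ennreal (exp (e * max_form I a p x)) * ennreal (exp (t * linform I (a ?j) y))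
          \<partial>std_gauss_PiM I)"
      by (simp add: exp_add ennreal_mult)
    also have "\<dots> = ennreal (exp (e * max_form I a p x)) * ennreal (exp (t\<^sup>2 * (\<Sum>i\<in>I. (a ?j i)\<^sup>2) / 2))"
      by (subst nn_integral_cmult) (auto simp: nn_integral_exp_linform[OF I])
    also have "\<dots> \<le> ennreal (exp (e * max_form I a p x)) * ennreal (exp (t\<^sup>2 * L\<^sup>2 / 2))"
      using L[OF max_index(1)[OF p]]
      by (intro mult_left_mono ennreal_leI) (auto intro!: mult_left_mono)
    finally show ?thesis by (simp add: mult.commute)
  qed
  then have "(\<integral>\<^sup>+x. \<integral>\<^sup>+y. ennreal (exp (e * max_form I a p x + t * linform I (a (max_index I a p x)) y))
        \<partial>std_gauss_PiM I \<partial>std_gauss_PiM I) \<le>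
      (\<integral>\<^sup>+x. ennreal (exp (t\<^sup>2 * L\<^sup>2 / 2)) * ennreal (exp (e * max_form I a p x)) \<partial>std_gauss_PiM I)"
    by (intro nn_integral_mono)
  also have "\<dots> = ennreal (exp (t\<^sup>2 * L\<^sup>2 / 2)) * (\<integral>\<^sup>+x. ennreal (exp (e * max_form I a p x)) \<partial>std_gauss_PiM I)"
    by (rule nn_integral_cmult) measurable
  finally show ?thesis .
qed

lemma one_minus_cos_le: "1 - cos (d::real) \<le> d\<^sup>2 / 2"
proof -
  have "cos d = 1 - 2 * (sin (d / 2))\<^sup>2" using cos_double_sin[of "d / 2"] by simp
  moreover have "(sin (d / 2))\<^sup>2 \<le> (d / 2)\<^sup>2"
    using abs_sin_x_le_abs_x[of "d / 2"] by (simp only: abs_le_square_iff)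
  ultimately show ?thesis by (simp add: power_divide)
qed

text \<open>
  The quarter circle from \<open>y\<close> to \<open>x\<close> is cut into \<open>m\<close> arcs. Jensen's inequality
  distributes the exponential of the sum of the increments over the arcs, and by rotation
  invariance every arc contributes the same integral, in which position and velocity are
  independent standard Gaussian vectors.
\<close>

lemma nn_integral_exp_max_form_diff_discrete:
  fixes I :: "'i set"
  assumes I: "finite I" and p: "p > 0" and l: "l \<ge> 0" and m: "m > 0"
    and L: "\<And>j. j < p \<Longrightarrow> (\<Sum>i\<in>I. (a j i)\<^sup>2) \<le> L\<^sup>2"
    and small: "l * pi\<^sup>2 / (8 * real m) \<le> 1"
  shows "(\<integral>\<^sup>+y. \<integral>\<^sup>+x. ennreal (exp (l * (max_form I a p x - max_form I a p y)))
        \<partial>std_gauss_PiM I \<partial>std_gauss_PiM I)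
    \<le> ennreal (exp (l\<^sup>2 * pi\<^sup>2 * L\<^sup>2 / 8) * (1 + l * pi\<^sup>2 / (8 * real m) * (real p * exp (L\<^sup>2 / 2))))"
proof -
  let ?G = "std_gauss_PiM I"
  let ?F = "max_form I a p"
  interpret G: prob_space ?G by (rule prob_space_std_gauss_PiM)
  define d where "d = pi / (2 * real m)"
  have d: "0 < d" using m by (simp add: d_def)
  have md: "real m * d = pi / 2" using m by (simp add: d_def)
  define e where "e = l * (real m * (1 - cos d))"
  define t where "t = l * (real m * sin d)"
  define X where "X = (\<lambda>j (y :: 'i \<Rightarrow> real) (x :: 'i \<Rightarrow> real) i. cos (real j * d) * y i + sin (real j * d) * x i)"
  define X' where "X' = (\<lambda>j (y :: 'i \<Rightarrow> real) (x :: 'i \<Rightarrow> real) i. cos (real j * d) * x i - sin (real j * d) * y i)"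
  define H where "H = (\<lambda>(u, v). ennreal (exp (e * ?F u + t * linform I (a (max_index I a p u)) v)))"
  have [measurable]: "H \<in> borel_measurable (PiM I (\<lambda>_. borel) \<Otimes>\<^sub>M PiM I (\<lambda>_. borel))"
  proof -
    have "(\<lambda>w. linform I (a (max_index I a p (fst w))) (snd w)) \<in>
        borel_measurable (PiM I (\<lambda>_. borel) \<Otimes>\<^sub>M PiM I (\<lambda>_. borel))"
      by (rule measurable_compose_countable[where f="\<lambda>j w. linform I (a j) (snd w)"]) measurable
    then show ?thesis unfolding H_def split_beta' by measurable
  qed
  \<comment> \<open>After Jensen, the increments enter with the weight \<open>m\<close>: the velocity has the coefficient
    \<open>t \<le> l pi / 2\<close>, and the second-order term has the coefficient \<open>e\<close>, of order \<open>1 / m\<close>.\<close>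
  have e0: "0 \<le> e" using l by (simp add: e_def)
  have "e \<le> l * (real m * (d\<^sup>2 / 2))"
    unfolding e_def using l one_minus_cos_le by (intro mult_left_mono) auto
  also have "real m * (d\<^sup>2 / 2) = pi\<^sup>2 / (8 * real m)"
    using m by (simp add: d_def power2_eq_square field_simps)
  finally have e_le: "e \<le> l * pi\<^sup>2 / (8 * real m)" by simp
  then have e1: "e \<le> 1" using small by linarith
  have "\<bar>t\<bar> \<le> l * (real m * d)"
    unfolding t_def abs_mult using l d abs_sin_x_le_abs_x[of d]
    by (auto intro!: mult_left_mono)
  then have "\<bar>t\<bar> \<le> \<bar>l * (pi / 2)\<bar>" unfolding md using l by simp
  then have "t\<^sup>2 \<le> (l * (pi / 2))\<^sup>2" by (simp only: abs_le_square_iff)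
  then have t2: "t\<^sup>2 * L\<^sup>2 / 2 \<le> l\<^sup>2 * pi\<^sup>2 * L\<^sup>2 / 8"
    using mult_right_mono[of "t\<^sup>2" "(l * (pi / 2))\<^sup>2" "L\<^sup>2"] by (simp add: power_mult_distrib power_divide mult_ac)
  have pointwise: "ennreal (exp (l * (?F x - ?F y))) \<le>
      (\<Sum>j<m. ennreal (1 / real m) * H (restrict (X (Suc j) y x) I, restrict (X' (Suc j) y x) I))" for x y
  proof -
    define b where "b = (\<lambda>j. e * ?F (X (Suc j) y x)
      + t * linform I (a (max_index I a p (X (Suc j) y x))) (X' (Suc j) y x))"
    have inc: "l * (?F (X (Suc j) y x) - ?F (X j y x)) \<le> 1 / real m * b j" for j
    proof -
      have "?F (X (Suc j) y x) - ?F (X j y x) \<le> (1 - cos d) * ?F (X (Suc j) y x)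
          + sin d * linform I (a (max_index I a p (X (Suc j) y x))) (X' (Suc j) y x)"
      proof -
        have "real (Suc j) * d = real j * d + d" by (simp add: distrib_right)
        then show ?thesis
          unfolding X_def X'_def by (simp only: max_form_rotate_increment[OF p])
      qed
      then have "l * (?F (X (Suc j) y x) - ?F (X j y x)) \<le> l * ((1 - cos d) * ?F (X (Suc j) y x)
          + sin d * linform I (a (max_index I a p (X (Suc j) y x))) (X' (Suc j) y x))"
        using l by (rule mult_left_mono)
      also have "\<dots> = 1 / real m * b j"
      proof -
        have "b j = real m * (l * ((1 - cos d) * ?F (X (Suc j) y x)
            + sin d * linform I (a (max_index I a p (X (Suc j) y x))) (X' (Suc j) y x)))"
          by (simp add: b_def e_def t_def algebra_simps)
        then show ?thesis using m by simp
      qed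
      finally show ?thesis .
    qed
    have X0: "X 0 y x = y" by (simp add: X_def)
    have Xm: "X m y x = x" by (simp add: X_def md)
    have "l * (?F x - ?F y) = (\<Sum>j<m. l * (?F (X (Suc j) y x) - ?F (X j y x)))"
      using sum_lessThan_telescope[of "\<lambda>j. ?F (X j y x)" m] by (simp add: sum_distrib_left[symmetric] X0 Xm)
    also have "\<dots> \<le> (\<Sum>j<m. (1 / real m) *\<^sub>R b j)"
      using inc by (auto intro!: sum_mono)
    finally have "exp (l * (?F x - ?F y)) \<le> exp (\<Sum>j<m. (1 / real m) *\<^sub>R b j)" by simp
    also have "\<dots> \<le> (\<Sum>j<m. 1 / real m * exp (b j))"
      using m by (intro convex_on_sum[OF _ _ exp_convex]) auto
    finally have "ennreal (exp (l * (?F x - ?F y))) \<le> ennreal (\<Sum>j<m. 1 / real m * exp (b j))"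
      by (rule ennreal_leI)
    also have "\<dots> = (\<Sum>j<m. ennreal (1 / real m) * ennreal (exp (b j)))"
      by (simp add: sum_ennreal[symmetric] ennreal_mult[symmetric] del: sum_ennreal)
    finally show ?thesis by (simp add: H_def b_def)
  qed
  have rot: "(\<integral>\<^sup>+y. \<integral>\<^sup>+x. H (restrict (X j y x) I, restrict (X' j y x) I) \<partial>?G \<partial>?G) =
      (\<integral>\<^sup>+y. \<integral>\<^sup>+x. H (y, x) \<partial>?G \<partial>?G)" if "j \<le> m" for j
  proof -
    have "real j * d \<le> pi / 2"
      unfolding md[symmetric] using that d by (intro mult_right_mono) auto
    then have "cos (real j * d) \<ge> 0" using d by (intro cos_ge_zero) (auto intro: order_trans[of _ 0])
    \<comment> \<open>The angles stay in the first quadrant, away from the excluded half turn.\<close>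
    then have "cos (real j * d) \<noteq> -1" by linarith
    then show ?thesis
      unfolding X_def X'_def
      by (intro nn_integral_std_gauss_PiM_rotate I) (auto simp: sin_cos_squared_add2)
  qed
  define K where "K = (\<lambda>j w. H (restrict (X j (fst w) (snd w)) I, restrict (X' j (fst w) (snd w)) I))"
  have K: "K j \<in> borel_measurable (?G \<Otimes>\<^sub>M ?G)" for j
    unfolding K_def X_def X'_def by measurable
  have K2: "(\<lambda>x. K j (y, x)) \<in> borel_measurable ?G" if "y \<in> space ?G" for j y
    using K that by (rule measurable_Pair2)
  have K1: "(\<lambda>y. \<integral>\<^sup>+x. K j (y, x) \<partial>?G) \<in> borel_measurable ?G" for j
    using K by (rule G.borel_measurable_nn_integral_fst)
  have "(\<integral>\<^sup>+y. \<integral>\<^sup>+x. ennreal (exp (l * (?F x - ?F y))) \<partial>?G \<partial>?G) \<le>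
      (\<integral>\<^sup>+y. \<integral>\<^sup>+x. (\<Sum>j<m. ennreal (1 / real m) * K (Suc j) (y, x)) \<partial>?G \<partial>?G)"
    unfolding K_def fst_conv snd_conv by (intro nn_integral_mono pointwise)
  also have "\<dots> = (\<integral>\<^sup>+y. (\<Sum>j<m. ennreal (1 / real m) * (\<integral>\<^sup>+x. K (Suc j) (y, x) \<partial>?G)) \<partial>?G)"
  proof (rule nn_integral_cong)
    fix y assume y: "y \<in> space ?G"
    show "(\<integral>\<^sup>+x. (\<Sum>j<m. ennreal (1 / real m) * K (Suc j) (y, x)) \<partial>?G) =
        (\<Sum>j<m. ennreal (1 / real m) * (\<integral>\<^sup>+x. K (Suc j) (y, x) \<partial>?G))"
      by (subst nn_integral_sum)
         (intro borel_measurable_times_ennreal borel_measurable_const K2[OF y] sum.cong refl nn_integral_cmult)+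
  qed
  also have "\<dots> = (\<Sum>j<m. ennreal (1 / real m) * (\<integral>\<^sup>+y. \<integral>\<^sup>+x. K (Suc j) (y, x) \<partial>?G \<partial>?G))"
    by (subst nn_integral_sum)
       (intro borel_measurable_times_ennreal borel_measurable_const K1 sum.cong refl nn_integral_cmult)+
  also have "\<dots> = (\<Sum>j<m. ennreal (1 / real m) * (\<integral>\<^sup>+y. \<integral>\<^sup>+x. H (y, x) \<partial>?G \<partial>?G))"
    unfolding K_def fst_conv snd_conv
    by (intro sum.cong refl arg_cong2[where f="(*)"] rot) simp
  also have "\<dots> = (of_nat m * ennreal (1 / real m)) * (\<integral>\<^sup>+y. \<integral>\<^sup>+x. H (y, x) \<partial>?G \<partial>?G)"
    by (simp add: mult.assoc)
  also have "of_nat m * ennreal (1 / real m) = 1"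
    using m by (simp add: ennreal_of_nat_eq_real_of_nat ennreal_mult[symmetric])
  also have "1 * (\<integral>\<^sup>+y. \<integral>\<^sup>+x. H (y, x) \<partial>?G \<partial>?G) \<le>
      ennreal (exp (t\<^sup>2 * L\<^sup>2 / 2)) * (\<integral>\<^sup>+x. ennreal (exp (e * ?F x)) \<partial>?G)"
    unfolding H_def prod.case mult_1 by (rule nn_integral_exp_max_form_linform[OF I p L])
  also have "\<dots> \<le> ennreal (exp (l\<^sup>2 * pi\<^sup>2 * L\<^sup>2 / 8)) *
      ennreal (1 + l * pi\<^sup>2 / (8 * real m) * (real p * exp (L\<^sup>2 / 2)))"
  proof (rule mult_mono)
    show "ennreal (exp (t\<^sup>2 * L\<^sup>2 / 2)) \<le> ennreal (exp (l\<^sup>2 * pi\<^sup>2 * L\<^sup>2 / 8))"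
      using t2 by (intro ennreal_leI) simp
    have "(\<integral>\<^sup>+x. ennreal (exp (e * ?F x)) \<partial>?G) \<le> ennreal (1 + e * (real p * exp (L\<^sup>2 / 2)))"
      by (rule nn_integral_exp_small_max_form[OF I p e0 e1 L])
    also have "\<dots> \<le> ennreal (1 + l * pi\<^sup>2 / (8 * real m) * (real p * exp (L\<^sup>2 / 2)))"
      by (intro ennreal_leI add_left_mono mult_right_mono e_le) auto
    finally show "(\<integral>\<^sup>+x. ennreal (exp (e * ?F x)) \<partial>?G) \<le> \<dots>" .
  qed simp_all
  also have "\<dots> = ennreal (exp (l\<^sup>2 * pi\<^sup>2 * L\<^sup>2 / 8) *
      (1 + l * pi\<^sup>2 / (8 * real m) * (real p * exp (L\<^sup>2 / 2))))"
    by (rule ennreal_mult'[symmetric]) simp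
  finally show ?thesis .
qed

text \<open>
  The limit of infinitely many arcs.
\<close>

lemma nn_integral_exp_max_form_diff:
  assumes I: "finite I" and p: "p > 0" and l: "l \<ge> 0"
    and L: "\<And>j. j < p \<Longrightarrow> (\<Sum>i\<in>I. (a j i)\<^sup>2) \<le> L\<^sup>2"
  shows "(\<integral>\<^sup>+y. \<integral>\<^sup>+x. ennreal (exp (l * (max_form I a p x - max_form I a p y)))
        \<partial>std_gauss_PiM I \<partial>std_gauss_PiM I) \<le> ennreal (exp (l\<^sup>2 * pi\<^sup>2 * L\<^sup>2 / 8))"
proof (rule tendsto_lowerbound)
  let ?b = "\<lambda>m. exp (l\<^sup>2 * pi\<^sup>2 * L\<^sup>2 / 8) * (1 + l * pi\<^sup>2 / (8 * real m) * (real p * exp (L\<^sup>2 / 2)))"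
  have lim0: "(\<lambda>m. l * pi\<^sup>2 / (8 * real m)) \<longlonglongrightarrow> 0"
  proof -
    have "(\<lambda>m. (l * pi\<^sup>2 / 8) * inverse (real m)) \<longlonglongrightarrow> (l * pi\<^sup>2 / 8) * 0"
      by (intro tendsto_mult tendsto_const lim_inverse_n)
    then show ?thesis by (simp add: field_simps)
  qed
  have "?b \<longlonglongrightarrow> exp (l\<^sup>2 * pi\<^sup>2 * L\<^sup>2 / 8) * (1 + 0 * (real p * exp (L\<^sup>2 / 2)))"
    by (intro tendsto_intros lim0)
  then show "(\<lambda>m. ennreal (?b m)) \<longlonglongrightarrow> ennreal (exp (l\<^sup>2 * pi\<^sup>2 * L\<^sup>2 / 8))"
    by (intro tendsto_ennrealI) simp
  have "eventually (\<lambda>m. l * pi\<^sup>2 / (8 * real m) < 1) sequentially"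
    using lim0 by (rule order_tendstoD) simp
  then show "eventually (\<lambda>m. (\<integral>\<^sup>+y. \<integral>\<^sup>+x. ennreal (exp (l * (max_form I a p x - max_form I a p y)))
        \<partial>std_gauss_PiM I \<partial>std_gauss_PiM I) \<le> ennreal (?b m)) sequentially"
    using eventually_gt_at_top[of 0]
    by eventually_elim (intro nn_integral_exp_max_form_diff_discrete[OF I p l _ L]; simp)
qed simp

lemma integrable_exp_linform:
  assumes "finite I"
  shows "integrable (std_gauss_PiM I) (\<lambda>x. exp (t * linform I a x))"
proof (rule integrableI_nonneg)
  show "(\<integral>\<^sup>+x. ennreal (exp (t * linform I a x)) \<partial>std_gauss_PiM I) < \<infinity>"
    unfolding nn_integral_exp_linform[OF assms] by simp
qed simp_all

text \<open>
  Domination by exponentials of the linear forms and of their negatives, through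
  \<open>\<bar>u\<bar> \<le> exp u + exp (- u)\<close>.
\<close>

lemma integrable_max_form:
  assumes I: "finite I" and p: "p > 0"
  shows "integrable (std_gauss_PiM I) (max_form I a p)"
proof (rule Bochner_Integration.integrable_bound)
  let ?g = "\<lambda>x. \<Sum>j<p. exp (1 * linform I (a j) x) + exp (- 1 * linform I (a j) x)"
  show "integrable (std_gauss_PiM I) ?g"
    by (intro Bochner_Integration.integrable_sum Bochner_Integration.integrable_add integrable_exp_linform I)
  show "AE x in std_gauss_PiM I. norm (max_form I a p x) \<le> norm (?g x)"
  proof (rule AE_I2)
    fix x
    let ?u = "max_form I a p x"
    have "\<bar>?u\<bar> \<le> exp ?u + exp (- ?u)"
      using exp_ge_add_one_self[of ?u] exp_ge_add_one_self[of "- ?u"] exp_gt_zero[of ?u] exp_gt_zero[of "- ?u"]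
      by linarith
    also have "\<dots> \<le> ?g x"
      unfolding max_index(2)[OF p, symmetric, of I a x]
      using max_index(1)[OF p, of I a x]
        member_le_sum[of "max_index I a p x" "{..<p}"
          "\<lambda>j. exp (1 * linform I (a j) x) + exp (- 1 * linform I (a j) x)"]
      by (simp add: add_nonneg_nonneg)
    finally show "norm ?u \<le> norm (?g x)" by simp
  qed
qed measurable

text \<open>
  Jensen's inequality for the copy \<open>y\<close> replaces \<open>max_form I a p y\<close> by its mean in the bound
  for \<open>exp (l (max_form I a p x - max_form I a p y))\<close>; the Chernoff bound is then optimised at
  \<open>l = 4 s / (pi\<^sup>2 L\<^sup>2)\<close>. The bound does not depend on the number \<open>p\<close> of forms.
\<close>

proposition max_form_concentration:
  assumes I: "finite I" and p: "p > 0" and L0: "L > 0" and s: "s \<ge> 0"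
    and L: "\<And>j. j < p \<Longrightarrow> (\<Sum>i\<in>I. (a j i)\<^sup>2) \<le> L\<^sup>2"
  shows "emeasure (std_gauss_PiM I)
      {x \<in> space (std_gauss_PiM I). max_form I a p x \<ge> (\<integral>x. max_form I a p x \<partial>std_gauss_PiM I) + s}
    \<le> ennreal (exp (- 2 * s\<^sup>2 / (pi\<^sup>2 * L\<^sup>2)))"
proof -
  let ?G = "std_gauss_PiM I"
  let ?F = "max_form I a p"
  interpret G: prob_space ?G by (rule prob_space_std_gauss_PiM)
  define E where "E = (\<integral>x. ?F x \<partial>?G)"
  define l where "l = 4 * s / (pi\<^sup>2 * L\<^sup>2)"
  have l: "l \<ge> 0" using s by (simp add: l_def)
  have F: "integrable ?G ?F" by (rule integrable_max_form[OF I p])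
  have jensen: "ennreal (exp (- l * E)) \<le> (\<integral>\<^sup>+y. ennreal (exp (- l * ?F y)) \<partial>?G)"
  proof -
    have int: "integrable ?G (\<lambda>y. exp (- l * ?F y))"
    proof (rule Bochner_Integration.integrable_bound[OF integrable_exp_linform[OF I, of "-l" "a 0"]])
      show "AE y in ?G. norm (exp (- l * ?F y)) \<le> norm (exp (- l * linform I (a 0) y))"
        using linform_le_max_form[OF p] l by (intro AE_I2) (auto intro!: mult_left_mono)
    qed measurable
    have "exp (- l * E) = (\<integral>y. exp (- l * E) * (1 + l * E - l * ?F y) \<partial>?G)"
      using F by (simp add: G.prob_space E_def)
    also have "\<dots> \<le> (\<integral>y. exp (- l * ?F y) \<partial>?G)"
    proof (rule integral_mono[OF _ int])
      fix y
      \<comment> \<open>The tangent of the exponential function at the mean.\<close>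
      have "exp (- l * E) * (1 + (l * E - l * ?F y)) \<le> exp (- l * E) * exp (l * E - l * ?F y)"
        by (intro mult_left_mono exp_ge_add_one_self) auto
      also have "\<dots> = exp (- l * ?F y)" by (simp add: exp_add[symmetric])
      finally show "exp (- l * E) * (1 + l * E - l * ?F y) \<le> exp (- l * ?F y)"
        by (simp add: add_diff_eq)
    qed (use F in auto)
    finally show ?thesis
      by (subst nn_integral_eq_integral[OF int]) (auto intro: ennreal_leI)
  qed
  have "ennreal (exp (- l * E)) * (\<integral>\<^sup>+x. ennreal (exp (l * ?F x)) \<partial>?G) \<le>
      (\<integral>\<^sup>+y. ennreal (exp (- l * ?F y)) \<partial>?G) * (\<integral>\<^sup>+x. ennreal (exp (l * ?F x)) \<partial>?G)"
    by (intro mult_right_mono jensen) simp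
  also have "\<dots> = (\<integral>\<^sup>+y. \<integral>\<^sup>+x. ennreal (exp (- l * ?F y)) * ennreal (exp (l * ?F x)) \<partial>?G \<partial>?G)"
  proof -
    have "(\<integral>\<^sup>+y. \<integral>\<^sup>+x. ennreal (exp (- l * ?F y)) * ennreal (exp (l * ?F x)) \<partial>?G \<partial>?G) =
        (\<integral>\<^sup>+y. ennreal (exp (- l * ?F y)) * (\<integral>\<^sup>+x. ennreal (exp (l * ?F x)) \<partial>?G) \<partial>?G)"
      by (intro nn_integral_cong nn_integral_cmult) measurable
    also have "\<dots> = (\<integral>\<^sup>+y. ennreal (exp (- l * ?F y)) \<partial>?G) * (\<integral>\<^sup>+x. ennreal (exp (l * ?F x)) \<partial>?G)"
      by (intro nn_integral_multc) measurable
    finally show ?thesis by simp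
  qed
  also have "\<dots> = (\<integral>\<^sup>+y. \<integral>\<^sup>+x. ennreal (exp (l * (?F x - ?F y))) \<partial>?G \<partial>?G)"
    by (simp add: ennreal_mult[symmetric] exp_add[symmetric] algebra_simps)
  also have "\<dots> \<le> ennreal (exp (l\<^sup>2 * pi\<^sup>2 * L\<^sup>2 / 8))"
    by (rule nn_integral_exp_max_form_diff[OF I p l L])
  finally have mgf: "ennreal (exp (- l * E)) * (\<integral>\<^sup>+x. ennreal (exp (l * ?F x)) \<partial>?G) \<le> \<dots>" .
  have "emeasure ?G {x \<in> space ?G. ?F x \<ge> E + s} =
      (\<integral>\<^sup>+x. indicator {x \<in> space ?G. ?F x \<ge> E + s} x \<partial>?G)"
    by (intro nn_integral_indicator[symmetric]) measurable
  also have "\<dots> \<le> (\<integral>\<^sup>+x. ennreal (exp (- l * s)) * (ennreal (exp (- l * E)) * ennreal (exp (l * ?F x))) \<partial>?G)"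
  proof (rule nn_integral_mono)
    fix x
    have "1 \<le> exp (- l * s) * (exp (- l * E) * exp (l * ?F x))" if "?F x \<ge> E + s"
      using mult_left_mono[OF that l] by (simp add: exp_add[symmetric] algebra_simps)
    then show "indicator {x \<in> space ?G. ?F x \<ge> E + s} x \<le>
        ennreal (exp (- l * s)) * (ennreal (exp (- l * E)) * ennreal (exp (l * ?F x)))"
      by (auto simp: indicator_def ennreal_mult[symmetric] ennreal_1[symmetric] simp del: ennreal_1 intro!: ennreal_leI)
  qed
  also have "\<dots> = ennreal (exp (- l * s)) * (ennreal (exp (- l * E)) * (\<integral>\<^sup>+x. ennreal (exp (l * ?F x)) \<partial>?G))"
    by (simp add: nn_integral_cmult)
  also have "\<dots> \<le> ennreal (exp (- l * s)) * ennreal (exp (l\<^sup>2 * pi\<^sup>2 * L\<^sup>2 / 8))"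
    by (intro mult_left_mono mgf) simp
  also have "\<dots> = ennreal (exp (- 2 * s\<^sup>2 / (pi\<^sup>2 * L\<^sup>2)))"
  proof -
    have "- l * s + l\<^sup>2 * pi\<^sup>2 * L\<^sup>2 / 8 = - 2 * s\<^sup>2 / (pi\<^sup>2 * L\<^sup>2)"
      using L0 by (simp add: l_def field_simps power2_eq_square)
    then show ?thesis by (simp add: ennreal_mult[symmetric] exp_add[symmetric])
  qed
  finally show ?thesis by (simp add: E_def)
qed

section \<open>Norms and dual norms in finite dimension\<close>

lemma
  assumes "is_norm N"
  shows is_norm_nonneg: "0 \<le> N x"
    and is_norm_eq_0: "N x = 0 \<longleftrightarrow> x = 0"
    and is_norm_scaleR: "N (c *\<^sub>R x) = \<bar>c\<bar> * N x"
    and is_norm_triangle: "N (x + y) \<le> N x + N y"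
    and is_norm_0: "N 0 = 0"
  using assms unfolding is_norm_def by blast+

lemma is_norm_upper_bound:
  fixes N :: "'v::euclidean_space \<Rightarrow> real"
  assumes N: "is_norm N"
  obtains B where "\<And>x. N x \<le> B * norm x"
proof
  fix x :: 'v
  have sub: "N (\<Sum>b\<in>S. f b) \<le> (\<Sum>b\<in>S. N (f b))" if "finite S" for S and f :: "'v \<Rightarrow> 'v"
    using that
  proof (induction S rule: finite_induct)
    case empty
    then show ?case by (simp add: is_norm_0[OF N])
  next
    case (insert b S)
    have "N (f b + sum f S) \<le> N (f b) + N (sum f S)" by (rule is_norm_triangle[OF N])
    then show ?case using insert by simp
  qed
  have "N x = N (\<Sum>b\<in>Basis. (x \<bullet> b) *\<^sub>R b)" by (simp add: euclidean_representation)
  also have "\<dots> \<le> (\<Sum>b\<in>Basis. N ((x \<bullet> b) *\<^sub>R b))" by (rule sub) simp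
  also have "\<dots> = (\<Sum>b\<in>Basis. \<bar>x \<bullet> b\<bar> * N b)" by (simp add: is_norm_scaleR[OF N])
  also have "\<dots> \<le> (\<Sum>b\<in>Basis. norm x * N b)"
    by (intro sum_mono mult_right_mono) (auto simp: is_norm_nonneg[OF N] Basis_le_norm)
  finally show "N x \<le> (\<Sum>b\<in>Basis. N b) * norm x" by (simp add: sum_distrib_left mult.commute)
qed

lemma is_norm_continuous:
  fixes N :: "'v::euclidean_space \<Rightarrow> real"
  assumes N: "is_norm N"
  shows "continuous_on UNIV N"
proof -
  obtain B where B: "\<And>x. N x \<le> B * norm x" using is_norm_upper_bound[OF N] by auto
  have "B \<ge> 0"
  proof -
    obtain b :: 'v where "b \<in> Basis" using SOME_Basis by blast
    then show ?thesis using order_trans[OF is_norm_nonneg[OF N] B[of b]] by simp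
  qed
  have tri: "N x - N y \<le> N (x - y)" for x y
  proof -
    have "N ((x - y) + y) \<le> N (x - y) + N y" by (rule is_norm_triangle[OF N])
    then show ?thesis by simp
  qed
  have "\<bar>N x - N y\<bar> \<le> B * norm (x - y)" for x y
    using tri[of x y] tri[of y x] B[of "x - y"] B[of "y - x"] by (simp add: norm_minus_commute)
  then have "B-lipschitz_on UNIV N"
    using \<open>B \<ge> 0\<close> by (intro lipschitz_onI) (auto simp: dist_norm dist_real_def)
  then show ?thesis by (rule lipschitz_on_continuous_on)
qed

text \<open>
  A norm in finite dimension is continuous and positive on the compact Euclidean sphere, hence
  bounded below there by a positive constant; the rest is homogeneity.
\<close>

lemma is_norm_lower_bound:
  fixes N :: "'v::euclidean_space \<Rightarrow> real"
  assumes N: "is_norm N"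
  obtains c where "\<And>x. norm x \<le> c * N x"
proof -
  obtain b :: 'v where b: "b \<in> Basis" using SOME_Basis by blast
  then have "b \<in> sphere 0 1" by simp
  then have "\<exists>z\<in>sphere 0 1. \<forall>x\<in>sphere 0 1. N z \<le> N x"
    by (intro continuous_attains_inf continuous_on_subset[OF is_norm_continuous[OF N]]) auto
  then obtain z where z: "z \<in> sphere 0 1" and le: "\<And>x. x \<in> sphere 0 1 \<Longrightarrow> N z \<le> N x"
    by blast
  have "z \<noteq> 0" using z by auto
  then have Nz: "N z > 0" using is_norm_nonneg[OF N, of z] is_norm_eq_0[OF N, of z] by simp
  have "norm x \<le> 1 / N z * N x" for x
  proof (cases "x = 0")
    case True
    then show ?thesis by (simp add: is_norm_0[OF N])
  next
    case False
    have "N z \<le> N ((1 / norm x) *\<^sub>R x)" using False by (intro le) simp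
    also have "\<dots> = \<bar>1 / norm x\<bar> * N x" by (rule is_norm_scaleR[OF N])
    finally show ?thesis using False Nz by (simp add: field_simps)
  qed
  then show ?thesis by (rule that)
qed

lemma is_norm_compact_ball:
  fixes N :: "'v::euclidean_space \<Rightarrow> real"
  assumes N: "is_norm N"
  shows "compact {x. N x \<le> r}"
proof -
  obtain c where c: "\<And>x. norm x \<le> c * N x" using is_norm_lower_bound[OF N] by auto
  have "norm x \<le> \<bar>c\<bar> * r" if "N x \<le> r" for x
  proof -
    have "norm x \<le> \<bar>c\<bar> * N x"
      using c[of x] mult_right_mono[OF abs_ge_self is_norm_nonneg[OF N], of c x] by linarith
    also have "\<dots> \<le> \<bar>c\<bar> * r" using that by (intro mult_left_mono) auto
    finally show ?thesis .
  qed
  then have "bounded {x. N x \<le> r}" by (auto simp: bounded_iff)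
  moreover have "closed {x. N x \<le> r}"
    using is_norm_continuous[OF N] by (intro closed_Collect_le) auto
  ultimately show ?thesis by (simp add: compact_eq_bounded_closed)
qed

lemma cSUP_upper_compact:
  fixes f :: "'a::topological_space \<Rightarrow> real"
  assumes "compact S" "continuous_on S f" "x \<in> S"
  shows "f x \<le> (SUP y\<in>S. f y)"
proof (rule cSUP_upper)
  show "bdd_above (f ` S)"
    using compact_continuous_image[OF assms(2,1)]
    by (rule bounded_imp_bdd_above[OF compact_imp_bounded])
qed fact

lemma tr_inner_eq_inner: "tr_inner B M = B \<bullet> M"
proof -
  have "tr_inner B M = (\<Sum>j\<in>UNIV. \<Sum>i\<in>UNIV. B $ i $ j * M $ i $ j)"
    by (simp add: tr_inner_def trace_def matrix_matrix_mult_def transpose_def)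
  also have "\<dots> = (\<Sum>i\<in>UNIV. \<Sum>j\<in>UNIV. B $ i $ j * M $ i $ j)" by (rule sum.swap)
  finally show ?thesis by (simp add: inner_vec_def)
qed

lemma dual_norm_eq_SUP_inner: "dual_norm N B = (SUP M\<in>{M. N M \<le> 1}. B \<bullet> M)"
proof -
  have "tr_inner B = (\<lambda>M. B \<bullet> M)" by (simp add: fun_eq_iff tr_inner_eq_inner)
  then show ?thesis by (simp add: dual_norm_def)
qed

lemma inner_le_dual_norm:
  assumes N: "is_norm N" and M: "N M \<le> 1"
  shows "B \<bullet> M \<le> dual_norm N B"
  unfolding dual_norm_eq_SUP_inner
proof (rule cSUP_upper_compact[OF is_norm_compact_ball[OF N]])
  show "continuous_on {M. N M \<le> 1} (\<lambda>M. B \<bullet> M)" by (intro continuous_intros)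
qed (use M in simp)

lemma is_norm_scale_to_unit:
  assumes "is_norm N" "r > 0" "N M \<le> r"
  shows "N ((1 / r) *\<^sub>R M) \<le> 1"
proof -
  have "N ((1 / r) *\<^sub>R M) = \<bar>1 / r\<bar> * N M" using assms(1) by (rule is_norm_scaleR)
  then show ?thesis using assms by simp
qed

lemma unit_ball_dense_sequence:
  fixes N :: "'v::euclidean_space \<Rightarrow> real"
  assumes N: "is_norm N"
  obtains v where "\<And>j :: nat. N (v j) \<le> 1" and "{M. N M \<le> 1} \<subseteq> closure (range v)"
proof -
  obtain D where D: "countable D" "D \<subseteq> {M. N M \<le> 1}" "{M. N M \<le> 1} \<subseteq> closure D"
    using separable[of "{M. N M \<le> 1}"] by blast
  have "0 \<in> {M. N M \<le> 1}" by (simp add: is_norm_0[OF N])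
  then have "D \<noteq> {}" using D by auto
  then have "range (from_nat_into D) = D" using D by (simp add: range_from_nat_into)
  then show ?thesis using D that[of "from_nat_into D"] by auto
qed

text \<open>
  By continuity of the pairing, the supremum over the unit ball equals the supremum along a dense
  sequence in it. This gives measurability, and it approximates the dual norm by maxima of finitely many
  linear forms.
\<close>

lemma less_dual_norm_iff:
  assumes N: "is_norm N" and v: "\<And>j :: nat. N (v j) \<le> 1" and dense: "{M. N M \<le> 1} \<subseteq> closure (range v)"
  shows "c < dual_norm N B \<longleftrightarrow> (\<exists>j. c < B \<bullet> v j)"
proof
  assume "c < dual_norm N B"
  then have "\<exists>M\<in>{M. N M \<le> 1}. c < B \<bullet> M"
    unfolding dual_norm_eq_SUP_inner
  proof (subst (asm) less_cSUP_iff)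
    show "{M. N M \<le> 1} \<noteq> {}" using v by auto
    show "bdd_above ((\<bullet>) B ` {M. N M \<le> 1})"
      by (rule bounded_imp_bdd_above[OF compact_imp_bounded[OF compact_continuous_image
          [OF _ is_norm_compact_ball[OF N]]]]) (intro continuous_intros)
  qed
  then obtain M where M: "N M \<le> 1" "c < B \<bullet> M" by auto
  have "open {M. c < B \<bullet> M}" by (intro open_Collect_less continuous_intros)
  then have "{M. c < B \<bullet> M} \<inter> range v \<noteq> {}"
    using M dense open_Int_closure_eq_empty[of "{M. c < B \<bullet> M}" "range v"] by auto
  then show "\<exists>j. c < B \<bullet> v j" by auto
next
  assume "\<exists>j. c < B \<bullet> v j"
  then show "c < dual_norm N B" using inner_le_dual_norm[OF N v] by (auto intro: less_le_trans)
qed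

lemma measurable_dual_norm:
  assumes N: "is_norm N"
  shows "dual_norm N \<in> borel_measurable borel"
proof -
  obtain v where v: "\<And>j :: nat. N (v j) \<le> 1" "{M. N M \<le> 1} \<subseteq> closure (range v)"
    using unit_ball_dense_sequence[OF N] by auto
  have "{B \<in> space borel. c < dual_norm N B} = (\<Union>j. {B. c < B \<bullet> v j})" for c
    using less_dual_norm_iff[OF N v] by auto
  moreover have "{B. c < B \<bullet> v j} \<in> sets borel" for c j
    by (intro borel_open open_Collect_less continuous_intros)
  ultimately show ?thesis
    unfolding borel_measurable_iff_greater by auto
qed

lemma dual_norm_abs_bound:
  fixes N :: "real ^ 'd2 ^ 'd1 \<Rightarrow> real"
  assumes N: "is_norm N"
  obtains C where "\<And>B. \<bar>dual_norm N B\<bar> \<le> C * norm B"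
proof -
  obtain c where c: "\<And>x. norm x \<le> c * N x" using is_norm_lower_bound[OF N] by auto
  have "\<bar>dual_norm N B\<bar> \<le> \<bar>c\<bar> * norm B" for B
  proof -
    have z: "N 0 \<le> 1" by (simp add: is_norm_0[OF N])
    have "0 \<le> dual_norm N B" using inner_le_dual_norm[OF N z, of B] by simp
    moreover have "dual_norm N B \<le> \<bar>c\<bar> * norm B"
      unfolding dual_norm_eq_SUP_inner
    proof (rule cSUP_least)
      show "{M. N M \<le> 1} \<noteq> {}" using z by auto
      fix M assume "M \<in> {M. N M \<le> 1}"
      then have M: "N M \<le> 1" by simp
      have "norm M \<le> \<bar>c\<bar> * N M"
        using c[of M] mult_right_mono[OF abs_ge_self is_norm_nonneg[OF N], of c M] by linarith
      also have "\<dots> \<le> \<bar>c\<bar> * 1" using M by (intro mult_left_mono) auto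
      finally have "norm B * norm M \<le> norm B * \<bar>c\<bar>" by (intro mult_left_mono) auto
      then show "B \<bullet> M \<le> \<bar>c\<bar> * norm B"
        using norm_cauchy_schwarz[of B M] by (simp add: mult.commute)
    qed
    ultimately show ?thesis by simp
  qed
  then show ?thesis by (rule that)
qed

lemma measurable_lincomb_PiM:
  fixes A :: "'i \<Rightarrow> 'v::euclidean_space"
  shows "(\<lambda>x. \<Sum>i\<in>I. x i *\<^sub>R A i) \<in> borel_measurable (PiM I (\<lambda>_. borel))"
  by measurable

section \<open>Gaussian concentration for the dual norm\<close>

text \<open>
  Without integrability the Bochner integral would be 0 by convention, and a bound on it would
  carry no information. The dual norm of the combination is dominated by a combination of the
  \<open>\<bar>x i\<bar>\<close>.
\<close>

lemma integrable_dual_norm_lincomb: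
  fixes A :: "'i \<Rightarrow> real ^ 'd2 ^ 'd1"
  assumes I: "finite I" and N: "is_norm N"
  shows "integrable (std_gauss_PiM I) (\<lambda>x. dual_norm N (\<Sum>i\<in>I. x i *\<^sub>R A i))"
proof -
  obtain C where C: "\<And>B. \<bar>dual_norm N B\<bar> \<le> C * norm B"
    using dual_norm_abs_bound[OF N] by auto
  have coord: "integrable (std_gauss_PiM I) (\<lambda>x. \<bar>x i\<bar>)" if i: "i \<in> I" for i
  proof -
    \<comment> \<open>A coordinate is the maximum of the single coordinate form.\<close>
    have "max_form I (\<lambda>_ k. if k = i then 1 else 0) 1 = (\<lambda>x. x i)"
      using i I by (simp add: max_form_def linform_def lessThan_Suc fun_eq_iff if_distrib[of "\<lambda>u. u * _"] cong: if_cong)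
    then show ?thesis
      using integrable_max_form[OF I, of 1 "\<lambda>_ k. if k = i then 1 else 0"] by simp
  qed
  show ?thesis
  proof (rule Bochner_Integration.integrable_bound)
    show "integrable (std_gauss_PiM I) (\<lambda>x. \<bar>C\<bar> * (\<Sum>i\<in>I. \<bar>x i\<bar> * norm (A i)))"
      by (intro integrable_mult_right Bochner_Integration.integrable_sum integrable_mult_left coord)
    show "(\<lambda>x. dual_norm N (\<Sum>i\<in>I. x i *\<^sub>R A i)) \<in> borel_measurable (std_gauss_PiM I)"
      using measurable_compose[OF measurable_lincomb_PiM measurable_dual_norm[OF N], of A I]
      by (simp cong: measurable_cong_sets sets_PiM_cong)
    show "AE x in std_gauss_PiM I. norm (dual_norm N (\<Sum>i\<in>I. x i *\<^sub>R A i)) \<le>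
        norm (\<bar>C\<bar> * (\<Sum>i\<in>I. \<bar>x i\<bar> * norm (A i)))"
    proof (rule AE_I2)
      fix x
      let ?S = "\<Sum>i\<in>I. x i *\<^sub>R A i"
      have "\<bar>dual_norm N ?S\<bar> \<le> \<bar>C\<bar> * norm ?S"
        using C[of ?S] by (meson abs_ge_self mult_right_mono norm_ge_zero order_trans)
      also have "\<dots> \<le> \<bar>C\<bar> * (\<Sum>i\<in>I. \<bar>x i\<bar> * norm (A i))"
        by (intro mult_left_mono order_trans[OF norm_sum]) auto
      finally show "norm (dual_norm N ?S) \<le> norm (\<bar>C\<bar> * (\<Sum>i\<in>I. \<bar>x i\<bar> * norm (A i)))"
        by (simp add: abs_mult sum_nonneg)
    qed
  qed
qed

text \<open>
  The dual norm of \<open>\<Sum>i. x\<^sub>i A\<^sub>i\<close> is the increasing limit of the maxima of the first \<open>p\<close>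
  linear forms \<open>x \<mapsto> \<Sum>i. x\<^sub>i (A\<^sub>i \<bullet> v\<^sub>j)\<close>. The finite maxima have smaller means and
  satisfy a bound independent of \<open>p\<close>, which therefore survives the limit.
\<close>

proposition dual_norm_concentration:
  fixes A :: "'i \<Rightarrow> real ^ 'd2 ^ 'd1"
  assumes I: "finite I" and N: "is_norm N" and L0: "L > 0" and s: "s \<ge> 0"
    and L: "\<And>M. N M \<le> 1 \<Longrightarrow> (\<Sum>i\<in>I. (A i \<bullet> M)\<^sup>2) \<le> L\<^sup>2"
    and E: "(\<integral>x. dual_norm N (\<Sum>i\<in>I. x i *\<^sub>R A i) \<partial>std_gauss_PiM I) \<le> \<Gamma>"
  shows "emeasure (std_gauss_PiM I)
      {x \<in> space (std_gauss_PiM I). dual_norm N (\<Sum>i\<in>I. x i *\<^sub>R A i) > \<Gamma> + s}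
    \<le> ennreal (exp (- 2 * s\<^sup>2 / (pi\<^sup>2 * L\<^sup>2)))"
proof -
  let ?G = "std_gauss_PiM I"
  obtain v where v: "\<And>j :: nat. N (v j) \<le> 1" "{M. N M \<le> 1} \<subseteq> closure (range v)"
    using unit_ball_dense_sequence[OF N] by auto
  define a where "a = (\<lambda>j i. A i \<bullet> v j)"
  have lin: "linform I (a j) x = (\<Sum>i\<in>I. x i *\<^sub>R A i) \<bullet> v j" for j x
    by (simp add: linform_def a_def inner_sum_left mult.commute)
  have max_le: "max_form I a (Suc p) x \<le> dual_norm N (\<Sum>i\<in>I. x i *\<^sub>R A i)" for p x
    unfolding max_index(2)[OF zero_less_Suc, symmetric] lin by (rule inner_le_dual_norm[OF N v(1)])
  define S where "S = (\<lambda>p. {x \<in> space ?G. max_form I a (Suc p) x > \<Gamma> + s})"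
  have S_sets: "S p \<in> sets ?G" for p unfolding S_def by measurable
  have "{x \<in> space ?G. dual_norm N (\<Sum>i\<in>I. x i *\<^sub>R A i) > \<Gamma> + s} = (\<Union>p. S p)"
  proof (intro set_eqI iffI)
    fix x assume "x \<in> {x \<in> space ?G. dual_norm N (\<Sum>i\<in>I. x i *\<^sub>R A i) > \<Gamma> + s}"
    then obtain j where "x \<in> space ?G" "linform I (a j) x > \<Gamma> + s"
      using less_dual_norm_iff[OF N v] by (auto simp: lin)
    then have "x \<in> S j"
      using linform_le_max_form[of j "Suc j" I a x] by (simp add: S_def)
    then show "x \<in> (\<Union>p. S p)" by blast
  next
    fix x assume "x \<in> (\<Union>p. S p)"
    then show "x \<in> {x \<in> space ?G. dual_norm N (\<Sum>i\<in>I. x i *\<^sub>R A i) > \<Gamma> + s}"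
      using max_le by (auto simp: S_def intro: less_le_trans)
  qed
  moreover have "emeasure ?G (\<Union>p. S p) = (SUP p. emeasure ?G (S p))"
  proof (rule SUP_emeasure_incseq[symmetric])
    show "range S \<subseteq> sets ?G" using S_sets by auto
    show "incseq S"
    proof (intro incseq_SucI subsetI)
      fix p x assume x: "x \<in> S p"
      have "max_form I a (Suc p) x \<le> max_form I a (Suc (Suc p)) x"
        unfolding max_form_def by (intro Max_mono) auto
      then show "x \<in> S (Suc p)" using x by (simp add: S_def)
    qed
  qed
  moreover have "emeasure ?G (S p) \<le> ennreal (exp (- 2 * s\<^sup>2 / (pi\<^sup>2 * L\<^sup>2)))" for p
  proof -
    have "(\<integral>x. max_form I a (Suc p) x \<partial>?G) \<le> (\<integral>x. dual_norm N (\<Sum>i\<in>I. x i *\<^sub>R A i) \<partial>?G)"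
      by (intro integral_mono integrable_max_form I integrable_dual_norm_lincomb N max_le) simp
    then have "(\<integral>x. max_form I a (Suc p) x \<partial>?G) \<le> \<Gamma>" using E by simp
    then have "emeasure ?G (S p) \<le> emeasure ?G
        {x \<in> space ?G. max_form I a (Suc p) x \<ge> (\<integral>x. max_form I a (Suc p) x \<partial>?G) + s}"
      by (intro emeasure_mono) (auto simp: S_def)
    also have "\<dots> \<le> ennreal (exp (- 2 * s\<^sup>2 / (pi\<^sup>2 * L\<^sup>2)))"
      using L[OF v(1)] by (intro max_form_concentration I L0 s) (auto simp: a_def)
    finally show ?thesis .
  qed
  ultimately show ?thesis by (simp add: SUP_least)
qed

lemma distr_indep_std_normal:
  assumes P: "prob_space P" and I: "I \<noteq> {}"
    and indep: "prob_space.indep_vars P (\<lambda>_. borel) X I"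
    and normal: "\<And>i. i \<in> I \<Longrightarrow> distributed P lborel (X i) std_normal_density"
  shows "distr P (PiM I (\<lambda>_. borel)) (\<lambda>\<omega>. \<lambda>i\<in>I. X i \<omega>) = std_gauss_PiM I"
proof -
  interpret P: prob_space P by fact
  have rv: "P.random_variable borel (X i)" if "i \<in> I" for i
    using distributed_measurable[OF normal[OF that]] by simp
  have "distr P (PiM I (\<lambda>_. borel)) (\<lambda>\<omega>. \<lambda>i\<in>I. X i \<omega>) = PiM I (\<lambda>i. distr P borel (X i))"
    using P.indep_vars_iff_distr_eq_PiM'[OF I rv] indep by simp
  also have "\<dots> = std_gauss_PiM I"
  proof (rule PiM_cong[OF refl])
    fix i assume i: "i \<in> I"
    have "distr P borel (X i) = distr P lborel (X i)" by (rule distr_cong) auto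
    also have "\<dots> = std_gauss" by (rule distributed_distr_eq_density[OF normal[OF i]])
    finally show "distr P borel (X i) = std_gauss" .
  qed
  finally show ?thesis .
qed

section \<open>Constrained least squares\<close>

text \<open>
  The strict inequality \<open>C < \<dots>\<close> is the union over \<open>m\<close> of the closed conditions
  \<open>C + 1 / (m + 1) \<le> \<dots>\<close>. For each \<open>m\<close> the triples of a signal, a minimizer and a noise term
  violating the bound by that margin form a closed set, and its projection along the compact set
  \<open>K \<times> K\<close> onto the noise is closed. So the set of bad noise terms is a countable union of closed
  sets, although it is described by uncountable quantifiers.
\<close>

lemma sets_exists_bad_minimizer:
  fixes h :: "'v::euclidean_space \<Rightarrow> real"
  assumes K: "compact K" and h: "continuous_on UNIV h"
  shows "{z. \<exists>M0\<in>K. \<exists>\<Phi>\<in>K. (\<forall>M\<in>K. h (\<Phi> - M0) - 2 * (z \<bullet> (\<Phi> - M0)) \<le> h (M - M0) - 2 * (z \<bullet> (M - M0)))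
      \<and> C < (norm (\<Phi> - M0))\<^sup>2} \<in> sets (borel :: 'v measure)"
proof -
  define T where "T = (\<lambda>m :: nat. {w :: ('v \<times> 'v) \<times> 'v.
      (\<forall>M\<in>K. h (snd (fst w) - fst (fst w)) - 2 * (snd w \<bullet> (snd (fst w) - fst (fst w)))
          \<le> h (M - fst (fst w)) - 2 * (snd w \<bullet> (M - fst (fst w))))
      \<and> C + inverse (real (Suc m)) \<le> (norm (snd (fst w) - fst (fst w)))\<^sup>2})"
  have h': "continuous_on S (\<lambda>x. h (f x))" if "continuous_on S f" for S :: "(('v \<times> 'v) \<times> 'v) set" and f
    using continuous_on_compose2[OF h that] by auto
  have "closed (T m)" for m
    unfolding T_def Ball_def
    by (intro closed_Collect_conj closed_Collect_all closed_Collect_imp open_Collect_const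
        closed_Collect_le h' continuous_intros)
  then have "closed {z. \<exists>w. w \<in> K \<times> K \<and> (w, z) \<in> T m}" for m
    by (intro closed_compact_projection compact_Times K)
  then have "(\<Union>m. {z. \<exists>w. w \<in> K \<times> K \<and> (w, z) \<in> T m}) \<in> sets borel"
    by (intro sets.countable_UN) auto
  also have "(\<Union>m. {z. \<exists>w. w \<in> K \<times> K \<and> (w, z) \<in> T m}) =
    {z. \<exists>M0\<in>K. \<exists>\<Phi>\<in>K. (\<forall>M\<in>K. h (\<Phi> - M0) - 2 * (z \<bullet> (\<Phi> - M0)) \<le> h (M - M0) - 2 * (z \<bullet> (M - M0)))
      \<and> C < (norm (\<Phi> - M0))\<^sup>2}" (is "?l = ?r")
  proof (intro set_eqI iffI)
    fix z assume "z \<in> ?l"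
    then obtain m M0 \<Phi> where *: "M0 \<in> K" "\<Phi> \<in> K" "((M0, \<Phi>), z) \<in> T m" by auto
    have opt: "\<forall>M\<in>K. h (\<Phi> - M0) - 2 * (z \<bullet> (\<Phi> - M0)) \<le> h (M - M0) - 2 * (z \<bullet> (M - M0))"
      and gap: "C + inverse (real (Suc m)) \<le> (norm (\<Phi> - M0))\<^sup>2"
      using *(3) by (auto simp only: T_def mem_Collect_eq fst_conv snd_conv)
    have "inverse (real (Suc m)) > 0" by simp
    then have "C < (norm (\<Phi> - M0))\<^sup>2" using gap by linarith
    then show "z \<in> ?r" using *(1,2) opt by blast
  next
    fix z assume "z \<in> ?r"
    then obtain M0 \<Phi> where *: "M0 \<in> K" "\<Phi> \<in> K"
        "\<forall>M\<in>K. h (\<Phi> - M0) - 2 * (z \<bullet> (\<Phi> - M0)) \<le> h (M - M0) - 2 * (z \<bullet> (M - M0))"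
        "C < (norm (\<Phi> - M0))\<^sup>2" by auto
    obtain m where "inverse (real (Suc m)) < (norm (\<Phi> - M0))\<^sup>2 - C"
      using reals_Archimedean[of "(norm (\<Phi> - M0))\<^sup>2 - C"] *(4) by auto
    then have "C + inverse (real (Suc m)) \<le> (norm (\<Phi> - M0))\<^sup>2" by linarith
    then have "((M0, \<Phi>), z) \<in> T m"
      using *(3) by (simp only: T_def mem_Collect_eq fst_conv snd_conv)
    then show "z \<in> ?l" using *(1,2) by blast
  qed
  finally show ?thesis .
qed

text \<open>
  Up to a term that does not involve \<open>M\<close>, the objective depends on the noise only through the
  combination \<open>\<Sum>k. e\<^sub>k A\<^sub>k\<close>. Both the error bound and the measurability of the good event rest
  on this.
\<close>

lemma least_squares_objective_shift:
  fixes A :: "'i \<Rightarrow> 'v::euclidean_space"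
  shows "(\<Sum>k\<in>I. (A k \<bullet> M0 + e k - A k \<bullet> M)\<^sup>2) =
    (\<Sum>k\<in>I. (e k)\<^sup>2) + ((\<Sum>k\<in>I. (A k \<bullet> (M - M0))\<^sup>2) - 2 * ((\<Sum>k\<in>I. e k *\<^sub>R A k) \<bullet> (M - M0)))"
proof -
  have "(A k \<bullet> M0 + e k - A k \<bullet> M)\<^sup>2 =
      (e k)\<^sup>2 + ((A k \<bullet> (M - M0))\<^sup>2 - 2 * (e k * (A k \<bullet> (M - M0))))" for k
    by (simp add: inner_diff_right power2_eq_square algebra_simps)
  then show ?thesis
    by (simp add: sum.distrib sum_subtractf sum_distrib_left inner_sum_left)
qed


text \<open>
  The deterministic part. Comparing the minimizer with the admissible point \<open>M0\<close> bounds the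
  empirical square norm of \<open>\<Phi> - M0\<close> by twice its inner product with the noise combination. The
  difference has \<open>N\<close>-norm at most \<open>2 \<alpha>\<close>, so after rescaling it to the unit ball, duality
  bounds the inner product and \<open>\<theta>\<close> controls the passage from the empirical to the Frobenius
  norm.
\<close>

lemma least_squares_error_bound:
  fixes A :: "nat \<Rightarrow> real ^ 'd2 ^ 'd1"
  assumes N: "is_norm N" and n: "n > 0" and \<alpha>: "\<alpha> > 0"
    and M0: "N M0 \<le> \<alpha>"
    and min: "is_arg_min (\<lambda>M. \<Sum>k=1..n. (A k \<bullet> M0 + e k - A k \<bullet> M)\<^sup>2) (\<lambda>M. N M \<le> \<alpha>) \<Phi>"
    and rip: "\<And>M. N M \<le> 1 \<Longrightarrow> \<bar>1 / real n * (\<Sum>k=1..n. (A k \<bullet> M)\<^sup>2) - (norm M)\<^sup>2\<bar> \<le> \<theta>"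
  shows "(norm (\<Phi> - M0))\<^sup>2 \<le>
    4 * \<alpha>\<^sup>2 * \<theta> + 4 * \<alpha> * dual_norm N (\<Sum>k=1..n. e k *\<^sub>R A k) / real n"
proof -
  let ?Z = "\<Sum>k=1..n. e k *\<^sub>R A k"
  define D where "D = (1 / (2 * \<alpha>)) *\<^sub>R (\<Phi> - M0)"
  have diff: "\<Phi> - M0 = (2 * \<alpha>) *\<^sub>R D" using \<alpha> by (simp add: D_def)
  have "N (\<Phi> - M0) \<le> N \<Phi> + N (- M0)"
    using is_norm_triangle[OF N, of \<Phi> "- M0"] by simp
  also have "N (- M0) = N M0" using is_norm_scaleR[OF N, of "- 1" M0] by simp
  finally have "N (\<Phi> - M0) \<le> 2 * \<alpha>" using min M0 by (simp add: is_arg_min_def)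
  then have D: "N D \<le> 1" unfolding D_def using \<alpha> by (intro is_norm_scale_to_unit[OF N]) auto
  have "\<not> (\<Sum>k=1..n. (A k \<bullet> M0 + e k - A k \<bullet> M0)\<^sup>2) < (\<Sum>k=1..n. (A k \<bullet> M0 + e k - A k \<bullet> \<Phi>)\<^sup>2)"
    using min M0 unfolding is_arg_min_def by blast
  then have "(\<Sum>k=1..n. (A k \<bullet> (\<Phi> - M0))\<^sup>2) \<le> 2 * (?Z \<bullet> (\<Phi> - M0))"
    unfolding least_squares_objective_shift by simp
  then have "(2 * \<alpha>)\<^sup>2 * (\<Sum>k=1..n. (A k \<bullet> D)\<^sup>2) \<le> 2 * (2 * \<alpha>) * (?Z \<bullet> D)"
    unfolding diff by (simp add: power_mult_distrib sum_distrib_left)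
  also have "\<dots> \<le> 2 * (2 * \<alpha>) * dual_norm N ?Z"
    using \<alpha> by (intro mult_left_mono inner_le_dual_norm N D) auto
  finally have basic: "4 * \<alpha>\<^sup>2 * (\<Sum>k=1..n. (A k \<bullet> D)\<^sup>2) \<le> 4 * \<alpha> * dual_norm N ?Z"
    by (simp add: power_mult_distrib)
  have "(norm (\<Phi> - M0))\<^sup>2 = 4 * \<alpha>\<^sup>2 * (norm D)\<^sup>2"
    unfolding diff by (simp add: power_mult_distrib)
  also have "\<dots> \<le> 4 * \<alpha>\<^sup>2 * (\<theta> + 1 / real n * (\<Sum>k=1..n. (A k \<bullet> D)\<^sup>2))"
    using rip[OF D] by (intro mult_left_mono) auto
  also have "\<dots> = 4 * \<alpha>\<^sup>2 * \<theta> + 4 * \<alpha>\<^sup>2 * (\<Sum>k=1..n. (A k \<bullet> D)\<^sup>2) / real n"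
    by (simp add: distrib_left)
  also have "\<dots> \<le> 4 * \<alpha>\<^sup>2 * \<theta> + 4 * \<alpha> * dual_norm N ?Z / real n"
    using basic by (intro add_left_mono divide_right_mono) auto
  finally show ?thesis .
qed

text \<open>
  The good event is the preimage, under the random matrix \<open>\<Sum>k. \<eta>\<^sub>k A\<^sub>k\<close>, of the complement
  of a Borel set of bad noise terms. Without measurability its probability would be 0 by
  convention.
\<close>

lemma sets_least_squares_good_event:
  fixes A :: "nat \<Rightarrow> real ^ 'd2 ^ 'd1" and \<eta> :: "nat \<Rightarrow> 'a \<Rightarrow> real"
  assumes N: "is_norm N" and \<eta>: "\<And>k. k \<in> {1..n} \<Longrightarrow> \<eta> k \<in> borel_measurable P"
  shows "{\<omega> \<in> space P. \<forall>M0. N M0 \<le> \<alpha> \<longrightarrow>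
      (\<forall>\<Phi>. is_arg_min (\<lambda>M. \<Sum>k=1..n. (A k \<bullet> M0 + \<eta> k \<omega> - A k \<bullet> M)\<^sup>2) (\<lambda>M. N M \<le> \<alpha>) \<Phi>
        \<longrightarrow> (norm (\<Phi> - M0))\<^sup>2 \<le> C)} \<in> sets P"
proof -
  define h where "h = (\<lambda>D. \<Sum>k=1..n. (A k \<bullet> D)\<^sup>2)"
  define K where "K = {M. N M \<le> \<alpha>}"
  define Z where "Z = (\<lambda>\<omega>. \<Sum>k=1..n. \<eta> k \<omega> *\<^sub>R A k)"
  define opt where "opt = (\<lambda>z M0 \<Phi>.
      \<forall>M\<in>K. h (\<Phi> - M0) - 2 * (z \<bullet> (\<Phi> - M0)) \<le> h (M - M0) - 2 * (z \<bullet> (M - M0)))"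
  define Bad where "Bad = {z. \<exists>M0\<in>K. \<exists>\<Phi>\<in>K. opt z M0 \<Phi> \<and> C < (norm (\<Phi> - M0))\<^sup>2}"
  have min_iff: "is_arg_min (\<lambda>M. \<Sum>k=1..n. (A k \<bullet> M0 + \<eta> k \<omega> - A k \<bullet> M)\<^sup>2) (\<lambda>M. N M \<le> \<alpha>) \<Phi>
      \<longleftrightarrow> \<Phi> \<in> K \<and> opt (Z \<omega>) M0 \<Phi>" for \<omega> M0 \<Phi>
  proof -
    have "is_arg_min (\<lambda>M. \<Sum>k=1..n. (A k \<bullet> M0 + \<eta> k \<omega> - A k \<bullet> M)\<^sup>2) (\<lambda>M. N M \<le> \<alpha>) \<Phi>
        \<longleftrightarrow> \<Phi> \<in> K \<and> \<not> (\<exists>M. M \<in> K \<and>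
          h (M - M0) - 2 * (Z \<omega> \<bullet> (M - M0)) < h (\<Phi> - M0) - 2 * (Z \<omega> \<bullet> (\<Phi> - M0)))"
      unfolding is_arg_min_def least_squares_objective_shift
      by (simp only: K_def h_def Z_def mem_Collect_eq add_less_cancel_left)
    then show ?thesis unfolding opt_def by (simp only: not_less Ball_def not_ex de_Morgan_conj imp_conv_disj)
  qed
  have "Bad \<in> sets borel"
    unfolding Bad_def opt_def K_def
  proof (rule sets_exists_bad_minimizer[OF is_norm_compact_ball[OF N]])
    show "continuous_on UNIV h" unfolding h_def by (intro continuous_intros)
  qed
  moreover have "Z \<in> borel_measurable P"
    unfolding Z_def by (intro borel_measurable_sum borel_measurable_scaleR borel_measurable_const \<eta>)
  ultimately have "Z -` (- Bad) \<inter> space P \<in> sets P" by (intro measurable_sets) auto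
  also have "Z -` (- Bad) \<inter> space P = {\<omega> \<in> space P. \<forall>M0. N M0 \<le> \<alpha> \<longrightarrow>
      (\<forall>\<Phi>. is_arg_min (\<lambda>M. \<Sum>k=1..n. (A k \<bullet> M0 + \<eta> k \<omega> - A k \<bullet> M)\<^sup>2) (\<lambda>M. N M \<le> \<alpha>) \<Phi>
        \<longrightarrow> (norm (\<Phi> - M0))\<^sup>2 \<le> C)}"
    unfolding min_iff Bad_def by (auto simp: K_def not_less)
  finally show ?thesis .
qed

theorem proposition1p1:
  fixes n :: nat
    and A :: "nat \<Rightarrow> real ^ 'd2 ^ 'd1"
    and N :: "real ^ 'd2 ^ 'd1 \<Rightarrow> real"
    and \<alpha> \<sigma> \<zeta> \<theta> \<Gamma> R :: real
    and P :: "'a measure" and \<eta> :: "nat \<Rightarrow> 'a \<Rightarrow> real"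
    and Q :: "'b measure" and g :: "nat \<Rightarrow> 'b \<Rightarrow> real"
  assumes n: "n > 0"
    and N: "is_norm N"
    and \<alpha>: "\<alpha> > 0" and \<sigma>: "\<sigma> > 0" and \<zeta>: "0 < \<zeta>" "\<zeta> < 1"
    and P: "prob_space P"
    and \<eta>_indep: "prob_space.indep_vars P (\<lambda>_. borel) \<eta> {1..n}"
    and \<eta>_normal: "\<And>k. k \<in> {1..n} \<Longrightarrow> distributed P lborel (\<eta> k) (normal_density 0 \<sigma>)"
    and Q: "prob_space Q"
    and g_indep: "prob_space.indep_vars Q (\<lambda>_. borel) g {1..n}"
    and g_normal: "\<And>k. k \<in> {1..n} \<Longrightarrow> distributed Q lborel (g k) std_normal_density"
    and \<theta>: "\<theta> > 0" and \<Gamma>: "\<Gamma> > 0"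
    and sup_le: "(SUP M\<in>{M. N M \<le> 1}.
                   \<bar>1 / real n * (\<Sum>k=1..n. (tr_inner (A k) M)\<^sup>2) - (norm M)\<^sup>2\<bar>) \<le> \<theta>"
    and expectation_le:
      "prob_space.expectation Q (\<lambda>x. dual_norm N (\<Sum>k=1..n. g k x *\<^sub>R A k)) \<le> \<Gamma>"
    and R: "R = (SUP M\<in>{M. N M \<le> 1}. norm M)"
  shows "\<P>(\<omega> in P. \<forall>M0. N M0 \<le> \<alpha> \<longrightarrow>
           (\<forall>\<Phi>. is_arg_min (\<lambda>M. \<Sum>k=1..n. (tr_inner (A k) M0 + \<eta> k \<omega> - tr_inner (A k) M)\<^sup>2)
                   (\<lambda>M. N M \<le> \<alpha>) \<Phi> \<longrightarrow>
              (norm (\<Phi> - M0))\<^sup>2 \<le>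
                4 * \<alpha>\<^sup>2 * \<theta> + 4 * \<alpha> * \<sigma> * \<Gamma> / real n
                + 2 * pi * \<alpha> * \<sigma> * sqrt (2 * ln (2 * inverse \<zeta>) * (\<theta> + R\<^sup>2) / real n)))
         \<ge> 1 - \<zeta>"
proof -
  interpret P: prob_space P by (rule P)
  define I where "I = {1..n}"
  have I: "finite I" "I \<noteq> {}" using n by (auto simp: I_def)
  let ?G = "std_gauss_PiM I"
  let ?B = "PiM I (\<lambda>_. borel) :: (nat \<Rightarrow> real) measure"
  define W where "W = (\<lambda>x. dual_norm N (\<Sum>k\<in>I. x k *\<^sub>R A k))"
  \<comment> \<open>\<open>L\<close> is a Lipschitz constant of the dual norm of the noise combination in the noise, and \<open>s\<close> is
    the deviation at which the Gaussian tail bound equals \<open>\<zeta> / 2\<close>.\<close>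
  define L where "L = sqrt (real n * (\<theta> + R\<^sup>2))"
  define s where "s = pi / 2 * L * sqrt (2 * ln (2 * inverse \<zeta>))"
  define C where "C = 4 * \<alpha>\<^sup>2 * \<theta> + 4 * \<alpha> * \<sigma> * \<Gamma> / real n
    + 2 * pi * \<alpha> * \<sigma> * sqrt (2 * ln (2 * inverse \<zeta>) * (\<theta> + R\<^sup>2) / real n)"
  define E where "E = {\<omega> \<in> space P. \<forall>M0. N M0 \<le> \<alpha> \<longrightarrow>
      (\<forall>\<Phi>. is_arg_min (\<lambda>M. \<Sum>k=1..n. (A k \<bullet> M0 + \<eta> k \<omega> - A k \<bullet> M)\<^sup>2) (\<lambda>M. N M \<le> \<alpha>) \<Phi>
        \<longrightarrow> (norm (\<Phi> - M0))\<^sup>2 \<le> C)}"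

  have rip: "\<bar>1 / real n * (\<Sum>k=1..n. (A k \<bullet> M)\<^sup>2) - (norm M)\<^sup>2\<bar> \<le> \<theta>" if "N M \<le> 1" for M
  proof -
    have "\<bar>1 / real n * (\<Sum>k=1..n. (A k \<bullet> M)\<^sup>2) - (norm M)\<^sup>2\<bar> \<le>
        (SUP M\<in>{M. N M \<le> 1}. \<bar>1 / real n * (\<Sum>k=1..n. (A k \<bullet> M)\<^sup>2) - (norm M)\<^sup>2\<bar>)"
    proof (rule cSUP_upper_compact[OF is_norm_compact_ball[OF N]])
      show "continuous_on {M. N M \<le> 1} (\<lambda>M. \<bar>1 / real n * (\<Sum>k=1..n. (A k \<bullet> M)\<^sup>2) - (norm M)\<^sup>2\<bar>)"
        by (intro continuous_intros)
    qed (use that in simp)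
    then show ?thesis using sup_le by (simp add: tr_inner_eq_inner)
  qed
  have norm_le_R: "norm M \<le> R" if "N M \<le> 1" for M
    unfolding R
  proof (rule cSUP_upper_compact[OF is_norm_compact_ball[OF N]])
    show "continuous_on {M. N M \<le> 1} norm" by (intro continuous_intros)
  qed (use that in simp)
  have "\<theta> + R\<^sup>2 > 0" using \<theta> by (simp add: add_pos_nonneg)
  then have L_sq: "L\<^sup>2 = real n * (\<theta> + R\<^sup>2)" and L0: "L > 0" using n by (simp_all add: L_def)
  have lipschitz: "(\<Sum>k\<in>I. (A k \<bullet> M)\<^sup>2) \<le> L\<^sup>2" if M: "N M \<le> 1" for M
  proof -
    have "(norm M)\<^sup>2 \<le> R\<^sup>2" using norm_le_R[OF M] by (intro power_mono) auto
    then have "1 / real n * (\<Sum>k\<in>I. (A k \<bullet> M)\<^sup>2) \<le> \<theta> + R\<^sup>2"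
      using rip[OF M] by (simp add: I_def)
    then show ?thesis using n by (simp add: L_sq field_simps)
  qed

  have ln_pos: "ln (2 * inverse \<zeta>) > 0"
    using \<zeta> by (intro ln_gt_zero) (simp add: field_simps)
  have s0: "s \<ge> 0" using L0 ln_pos by (simp add: s_def)
  have tail: "exp (- 2 * s\<^sup>2 / (pi\<^sup>2 * L\<^sup>2)) \<le> \<zeta>"
  proof -
    have "s\<^sup>2 = pi\<^sup>2 * L\<^sup>2 * ln (2 * inverse \<zeta>) / 2"
      using ln_pos by (simp add: s_def power_mult_distrib power_divide)
    then have "- 2 * s\<^sup>2 = - ln (2 * inverse \<zeta>) * (pi\<^sup>2 * L\<^sup>2)" by (simp add: mult_ac)
    then have "- 2 * s\<^sup>2 / (pi\<^sup>2 * L\<^sup>2) = - ln (2 * inverse \<zeta>)"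
      using L0 by (subst nonzero_divide_eq_eq) auto
    then have "exp (- 2 * s\<^sup>2 / (pi\<^sup>2 * L\<^sup>2)) = \<zeta> / 2"
      using \<zeta> by (simp add: exp_minus)
    then show ?thesis using \<zeta> by simp
  qed
  have C: "C = 4 * \<alpha>\<^sup>2 * \<theta> + 4 * \<alpha> * (\<sigma> * (\<Gamma> + s)) / real n"
  proof -
    have "sqrt (2 * ln (2 * inverse \<zeta>) * (\<theta> + R\<^sup>2) / real n) =
        sqrt (2 * ln (2 * inverse \<zeta>)) * (L / real n)"
    proof -
      have "(\<theta> + R\<^sup>2) / real n = real n * (\<theta> + R\<^sup>2) / (real n)\<^sup>2"
        using n by (simp add: power2_eq_square)
      then have "L / real n = sqrt ((\<theta> + R\<^sup>2) / real n)"
        by (simp add: L_def real_sqrt_divide)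
      then show ?thesis by (simp add: real_sqrt_mult[symmetric])
    qed
    then show ?thesis unfolding C_def s_def by (simp add: distrib_left add_divide_distrib mult_ac)
  qed

  have W_meas: "W \<in> borel_measurable ?B"
    unfolding W_def by (rule measurable_compose[OF measurable_lincomb_PiM measurable_dual_norm[OF N]])
  have expectation: "(\<integral>x. W x \<partial>?G) \<le> \<Gamma>"
  proof -
    have g: "g k \<in> borel_measurable Q" if "k \<in> I" for k
      using distributed_measurable[OF g_normal] that by (simp add: I_def)
    have "distr Q ?B (\<lambda>x. \<lambda>k\<in>I. g k x) = ?G"
      using g_indep g_normal by (intro distr_indep_std_normal Q I) (auto simp: I_def)
    then have "(\<integral>x. W x \<partial>?G) = (\<integral>x. W x \<partial>distr Q ?B (\<lambda>x. \<lambda>k\<in>I. g k x))" by simp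
    also have "\<dots> = (\<integral>x. W (\<lambda>k\<in>I. g k x) \<partial>Q)"
      by (intro integral_distr measurable_restrict g W_meas)
    also have "\<dots> \<le> \<Gamma>" using expectation_le by (simp add: W_def I_def)
    finally show ?thesis .
  qed

  \<comment> \<open>The noise is rescaled to standard Gaussian variables, whose joint law is the product measure.\<close>
  define \<xi> where "\<xi> = (\<lambda>k \<omega>. \<eta> k \<omega> / \<sigma>)"
  have \<eta>_\<xi>: "\<eta> k \<omega> = \<sigma> * \<xi> k \<omega>" for k \<omega> using \<sigma> by (simp add: \<xi>_def)
  have \<eta>: "\<eta> k \<in> borel_measurable P" if "k \<in> I" for k
    using distributed_measurable[OF \<eta>_normal] that by (simp add: I_def)
  have \<xi>: "\<xi> k \<in> borel_measurable P" if "k \<in> I" for k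
    unfolding \<xi>_def using \<eta>[OF that] by simp
  have distr_\<xi>: "distr P ?B (\<lambda>\<omega>. \<lambda>k\<in>I. \<xi> k \<omega>) = ?G"
  proof (rule distr_indep_std_normal[OF P I(2)])
    show "P.indep_vars (\<lambda>_. borel) \<xi> I"
      unfolding \<xi>_def I_def by (rule P.indep_vars_compose2[OF \<eta>_indep]) simp
    fix k assume "k \<in> I"
    then show "distributed P lborel (\<xi> k) std_normal_density"
      using \<eta>_normal P.normal_standard_normal_convert[OF \<sigma>, of "\<eta> k" 0] by (simp add: \<xi>_def I_def)
  qed
  define T where "T = {x \<in> space ?G. W x > \<Gamma> + s}"
  have space_G: "space ?G = space ?B" by (simp add: space_PiM)
  have T_sets: "T \<in> sets ?B"
    unfolding T_def space_G using W_meas by measurable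
  let ?\<xi> = "\<lambda>\<omega>. \<lambda>k\<in>I. \<xi> k \<omega>"
  have \<xi>_meas: "?\<xi> \<in> measurable P ?B" by (intro measurable_restrict \<xi>)
  have "emeasure P (?\<xi> -` T \<inter> space P) = emeasure (distr P ?B ?\<xi>) T"
    by (rule emeasure_distr[symmetric, OF \<xi>_meas T_sets])
  also have "\<dots> = emeasure ?G T" by (simp only: distr_\<xi>)
  also have "\<dots> \<le> ennreal (exp (- 2 * s\<^sup>2 / (pi\<^sup>2 * L\<^sup>2)))"
    unfolding T_def W_def
    using expectation[unfolded W_def] by (intro dual_norm_concentration I N L0 s0 lipschitz)
  also have "\<dots> \<le> ennreal \<zeta>" using tail by (rule ennreal_leI)
  finally have "P.prob (?\<xi> -` T \<inter> space P) \<le> \<zeta>"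
    using \<zeta> by (simp add: P.emeasure_eq_measure)
  moreover have "P.prob (space P - ?\<xi> -` T \<inter> space P) = 1 - P.prob (?\<xi> -` T \<inter> space P)"
    by (rule P.prob_compl) (rule measurable_sets[OF \<xi>_meas T_sets])
  moreover have "P.prob (space P - ?\<xi> -` T \<inter> space P) \<le> P.prob E"
  proof (rule P.finite_measure_mono)
    show "E \<in> sets P"
      unfolding E_def by (rule sets_least_squares_good_event[OF N]) (use \<eta> in \<open>simp add: I_def\<close>)
    show "space P - ?\<xi> -` T \<inter> space P \<subseteq> E"
    proof
      fix \<omega> assume \<omega>: "\<omega> \<in> space P - ?\<xi> -` T \<inter> space P"
      then have "?\<xi> \<omega> \<in> space ?G"
        unfolding space_G using measurable_space[OF \<xi>_meas] by blast
      then have W_le: "W (?\<xi> \<omega>) \<le> \<Gamma> + s" using \<omega> by (auto simp: T_def)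
      have noise: "(\<Sum>k=1..n. \<eta> k \<omega> *\<^sub>R A k) = \<sigma> *\<^sub>R (\<Sum>k\<in>I. ?\<xi> \<omega> k *\<^sub>R A k)"
        by (simp add: \<eta>_\<xi> I_def scaleR_sum_right)
      have dual_le: "dual_norm N (\<Sum>k=1..n. \<eta> k \<omega> *\<^sub>R A k) \<le> \<sigma> * (\<Gamma> + s)"
        unfolding dual_norm_eq_SUP_inner
      proof (rule cSUP_least)
        show "{M. N M \<le> 1} \<noteq> {}" using is_norm_0[OF N] by (auto intro!: exI[of _ 0])
        fix M assume "M \<in> {M. N M \<le> 1}"
        then have "(\<Sum>k\<in>I. ?\<xi> \<omega> k *\<^sub>R A k) \<bullet> M \<le> \<Gamma> + s"
          using inner_le_dual_norm[OF N, of M "\<Sum>k\<in>I. ?\<xi> \<omega> k *\<^sub>R A k"] W_le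
          unfolding W_def by simp
        then show "(\<Sum>k=1..n. \<eta> k \<omega> *\<^sub>R A k) \<bullet> M \<le> \<sigma> * (\<Gamma> + s)"
          unfolding noise using \<sigma> by simp
      qed
      have "(norm (\<Phi> - M0))\<^sup>2 \<le> C"
        if "N M0 \<le> \<alpha>"
          "is_arg_min (\<lambda>M. \<Sum>k=1..n. (A k \<bullet> M0 + \<eta> k \<omega> - A k \<bullet> M)\<^sup>2) (\<lambda>M. N M \<le> \<alpha>) \<Phi>" for M0 \<Phi>
      proof -
        have "(norm (\<Phi> - M0))\<^sup>2 \<le>
            4 * \<alpha>\<^sup>2 * \<theta> + 4 * \<alpha> * dual_norm N (\<Sum>k=1..n. \<eta> k \<omega> *\<^sub>R A k) / real n"
          by (rule least_squares_error_bound[OF N n \<alpha> that rip])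
        also have "\<dots> \<le> C"
          unfolding C using dual_le \<alpha> by (intro add_left_mono divide_right_mono mult_left_mono) auto
        finally show ?thesis .
      qed
      then show "\<omega> \<in> E" using \<omega> by (auto simp: E_def)
    qed
  qed
  ultimately have "P.prob E \<ge> 1 - \<zeta>" by linarith
  then show ?thesis unfolding E_def C_def tr_inner_eq_inner .
qed

end
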